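(* Let $A=kQ_A/I_A$ be a finite dimensional radical square zero algebra and let $B=kQ_B/I_B$ be the algebra obtained from $A$ by gluing two arrows $\alpha:e_1\to e_2$ and $\beta:e_{n-1}\to e_n$ from the same block of $A$. If $Z_{spp}(\alpha,\beta)=0$ and $\mathrm{char}(k)=0$, then there is a Lie algebra isomorphism $$\mathrm{HH}^{1}(B)\simeq\mathrm{HH}^{1}(A)\times k.$$
   Context: Let $k$ be a field. Paths are composed from right to left: $p=a_r\cdots a_1$ has $s(p)=s(a_1)$, $t(p)=t(a_r)$; vertices are identified with trivial paths and with the corresponding idempotents. A finite dimensional monomial algebra is a finite dimensional algebra $A=kQ_A/I_A$, where $Q_A$ is a finite quiver (vertex set $(Q_A)_0$, arrow set $(Q_A)_1$) and $I_A$ is an admissible ideal generated by a set $Z_A$ of paths of length $\ge 2$ which is minimal (no proper subpath of an element of $Z_A$ lies in $Z_A$). $A$ is radical square zero if $I_A$ is generated by all paths of length 2. $\mathcal{B}_A$ is the set of paths of $Q_A$ (including trivial ones) containing no element of $Z_A$ as a subpath; it gives a $k$-basis of $A$. Blocks of $A$ correspond to connected components of $Q_A$. Gluing two arrows. $Q_A$ has vertices $e_1,\dots,e_n$ ($n\ge 4$) and arrows $\alpha,\beta,\gamma_1,\dots,\gamma_m$ ($m\ge 0$) with $\alpha:e_1\to e_2$, $\beta:e_{n-1}\to e_n$, and $e_1,e_2,e_{n-1},e_n$ pairwise different. The algebra $B$ obtained by gluing $\alpha$ and $\beta$ is the subalgebra of $A$ generated by $f_1:=e_1+e_{n-1}$,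 $f_2:=e_2+e_n$, $f_i:=e_i$ ($3\le i\le n-2$), $\gamma^*:=\alpha+\beta$, $\gamma_j^*:=\gamma_j$ ($1\le j\le m$). Then $B\simeq kQ_B/I_B$, where $Q_B$ is obtained from $Q_A$ by identifying $\alpha$ with $\beta$ (so $e_1$ with $e_{n-1}$ and $e_2$ with $e_n$). Write $a\mapsto a^*$ for the induced map on arrows ($\alpha^*=\beta^*=\gamma^*$), $e_i^*=f_i$ for $3\le i\le n-2$, $e_1^*=e_{n-1}^*=f_1$, $e_2^*=e_n^*=f_2$, and $p\mapsto p^*$ for the induced map on paths. When $A$ is radical square zero, so is $B$, i.e. $I_B$ is generated by all paths of length 2 of $Q_B$; $Z_B$, $\mathcal{B}_B$ are defined as for $A$. Complex. Paths $\epsilon,\gamma$ are parallel ($\epsilon\|\gamma$) if they have the same start and the same end; otherwise $\epsilon\nparallel\gamma$. For sets $X,Y$ of paths, $k(X\|Y)$ is the vector space with basis the pairs $\epsilon\|\gamma$ of parallel paths, $\epsilon\in X,\gamma\in Y$. For a monomial algebra with data $(Q,Z,\mathcal{B})$ consider $k(Q_0\|\mathcal{B})\xrightarrow{\delta^0}k(Q_1\|\mathcal{B})\xrightarrow{\delta^1}k(Z\|\mathcal{B})$, where $\delta^0(e\|\gamma)=\sum_{s(a)=e,\,a\gamma\in\mathcal{B}}a\|a\gamma-\sum_{t(a)=e,\,\gamma a\in\mathcal{B}}a\|\gamma a$ and $\delta^1(a\|\gamma)=\sum_{r\in Z}r\|r^{a\|\gamma}$, with $r^{a\|\gamma}$ the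 sum of all paths in $\mathcal{B}$ obtained by replacing one appearance of $a$ in $r$ by $\gamma$ (one summand for each appearance). Then $\mathrm{HH}^1=\mathrm{Ker}(\delta^1)/\mathrm{Im}(\delta^0)$, with Lie bracket induced by $[a\|\gamma,b\|\epsilon]=b\|\epsilon^{a\|\gamma}-a\|\gamma^{b\|\epsilon}$. In the product $\mathrm{HH}^1(A)\times k$, $k$ is the one-dimensional (abelian) Lie algebra. Special pairs. For an arrow $a\in(Q_A)_1$ and a path $p\in\mathcal{B}_A$, $(a,p)$ is a special pair if: (1) the starting or the ending vertex of $a$ is one of $e_1,e_2,e_{n-1},e_n$; (2) $a\nparallel p$ in $Q_A$; (3) $a^*\|p^*$ in $Q_B$ but $a^*\|p^*$ is not equal to $\gamma^*\|\gamma^*$; (4) if $a=\alpha$ (resp. $a=\beta$) then $p\nparallel\beta$ (resp. $p\nparallel\alpha$), and if $p=\alpha$ (resp. $p=\beta$) then $a\nparallel\beta$ (resp. $a\nparallel\alpha$). $\mathrm{Spp}(\alpha,\beta)$ is the set of special pairs, $\langle\mathrm{Spp}(\alpha,\beta)\rangle\subseteq k((Q_B)_1\|\mathcal{B}_B)$ is the span of the $a^*\|p^*$ with $(a,p)\in\mathrm{Spp}(\alpha,\beta)$, and $Z_{spp}(\alpha,\beta)=\langle\mathrm{Spp}(\alpha,\beta)\rangle\cap\mathrm{Ker}(\delta_B^1)$. *)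

theory Defs
  imports "HOL-Library.Poly_Mapping" "Graph_Theory.Graph_Theory"
begin

section \<open>Free vector spaces\<close>

text \<open>
  The vector space with basis a set \<open>X\<close> is the set of finitely supported functions
  \<open>f :: 'b \<Rightarrow>\<^sub>0 'k\<close> with \<open>keys f \<subseteq> X\<close>; the basis vector of \<open>x\<close> is \<open>single x 1\<close>.
\<close>

definition pm_scale :: "'k::field \<Rightarrow> ('b \<Rightarrow>\<^sub>0 'k) \<Rightarrow> ('b \<Rightarrow>\<^sub>0 'k)" where
  "pm_scale c f = Poly_Mapping.map ((*) c) f"

definition free_space :: "'b set \<Rightarrow> ('b \<Rightarrow>\<^sub>0 'k::field) set" where
  "free_space X = {f. Poly_Mapping.keys f \<subseteq> X}"

definition lin_ext :: "('b \<Rightarrow> ('c \<Rightarrow>\<^sub>0 'k::field)) \<Rightarrow> ('b \<Rightarrow>\<^sub>0 'k) \<Rightarrow> ('c \<Rightarrow>\<^sub>0 'k)" where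
  "lin_ext g f = (\<Sum>x\<in>Poly_Mapping.keys f. pm_scale (Poly_Mapping.lookup f x) (g x))"

lemma lookup_pm_scale [simp]: "Poly_Mapping.lookup (pm_scale c f) x = c * Poly_Mapping.lookup f x"
  by (simp add: pm_scale_def Poly_Mapping.map.rep_eq when_def)

lemma vector_space_pm_scale: "vector_space (pm_scale :: 'k::field \<Rightarrow> ('b \<Rightarrow>\<^sub>0 'k) \<Rightarrow> _)"
  by unfold_locales (auto intro!: poly_mapping_eqI simp: lookup_add algebra_simps)


section \<open>Lie algebras\<close>

record ('k, 'b) lie_data =
  lie_carrier :: "'b set"
  lie_add :: "'b \<Rightarrow> 'b \<Rightarrow> 'b"
  lie_zero :: "'b"
  lie_scale :: "'k \<Rightarrow> 'b \<Rightarrow> 'b"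
  lie_bracket :: "'b \<Rightarrow> 'b \<Rightarrow> 'b"

locale lie_algebra =
  fixes L :: "('k::field, 'b) lie_data"
  assumes zero_closed: "lie_zero L \<in> lie_carrier L"
    and add_closed: "\<lbrakk>x \<in> lie_carrier L; y \<in> lie_carrier L\<rbrakk> \<Longrightarrow> lie_add L x y \<in> lie_carrier L"
    and scale_closed: "x \<in> lie_carrier L \<Longrightarrow> lie_scale L c x \<in> lie_carrier L"
    and bracket_closed:
      "\<lbrakk>x \<in> lie_carrier L; y \<in> lie_carrier L\<rbrakk> \<Longrightarrow> lie_bracket L x y \<in> lie_carrier L"
    and add_assoc: "\<lbrakk>x \<in> lie_carrier L; y \<in> lie_carrier L; z \<in> lie_carrier L\<rbrakk> \<Longrightarrow>
      lie_add L (lie_add L x y) z = lie_add L x (lie_add L y z)"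
    and add_commute: "\<lbrakk>x \<in> lie_carrier L; y \<in> lie_carrier L\<rbrakk> \<Longrightarrow> lie_add L x y = lie_add L y x"
    and add_zero: "x \<in> lie_carrier L \<Longrightarrow> lie_add L (lie_zero L) x = x"
    and add_inverse: "x \<in> lie_carrier L \<Longrightarrow> \<exists>y\<in>lie_carrier L. lie_add L x y = lie_zero L"
    and scale_add: "\<lbrakk>x \<in> lie_carrier L; y \<in> lie_carrier L\<rbrakk> \<Longrightarrow>
      lie_scale L c (lie_add L x y) = lie_add L (lie_scale L c x) (lie_scale L c y)"
    and add_scale: "x \<in> lie_carrier L \<Longrightarrow>
      lie_scale L (c + d) x = lie_add L (lie_scale L c x) (lie_scale L d x)"
    and scale_scale: "x \<in> lie_carrier L \<Longrightarrow> lie_scale L c (lie_scale L d x) = lie_scale L (c * d) x"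
    and scale_one: "x \<in> lie_carrier L \<Longrightarrow> lie_scale L 1 x = x"
    and bracket_add_left: "\<lbrakk>x \<in> lie_carrier L; y \<in> lie_carrier L; z \<in> lie_carrier L\<rbrakk> \<Longrightarrow>
      lie_bracket L (lie_add L x y) z = lie_add L (lie_bracket L x z) (lie_bracket L y z)"
    and bracket_add_right: "\<lbrakk>x \<in> lie_carrier L; y \<in> lie_carrier L; z \<in> lie_carrier L\<rbrakk> \<Longrightarrow>
      lie_bracket L x (lie_add L y z) = lie_add L (lie_bracket L x y) (lie_bracket L x z)"
    and bracket_scale_left: "\<lbrakk>x \<in> lie_carrier L; y \<in> lie_carrier L\<rbrakk> \<Longrightarrow>
      lie_bracket L (lie_scale L c x) y = lie_scale L c (lie_bracket L x y)"
    and bracket_scale_right: "\<lbrakk>x \<in> lie_carrier L; y \<in> lie_carrier L\<rbrakk> \<Longrightarrow>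
      lie_bracket L x (lie_scale L c y) = lie_scale L c (lie_bracket L x y)"
    and bracket_self: "x \<in> lie_carrier L \<Longrightarrow> lie_bracket L x x = lie_zero L"
    and jacobi: "\<lbrakk>x \<in> lie_carrier L; y \<in> lie_carrier L; z \<in> lie_carrier L\<rbrakk> \<Longrightarrow>
      lie_add L (lie_bracket L x (lie_bracket L y z))
        (lie_add L (lie_bracket L y (lie_bracket L z x)) (lie_bracket L z (lie_bracket L x y)))
      = lie_zero L"

definition lie_iso :: "('k::field, 'b) lie_data \<Rightarrow> ('k, 'c) lie_data \<Rightarrow> ('b \<Rightarrow> 'c) set" where
  "lie_iso L M = {\<phi>. bij_betw \<phi> (lie_carrier L) (lie_carrier M) \<and>
     (\<forall>x\<in>lie_carrier L. \<forall>y\<in>lie_carrier L.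
        \<phi> (lie_add L x y) = lie_add M (\<phi> x) (\<phi> y) \<and>
        \<phi> (lie_bracket L x y) = lie_bracket M (\<phi> x) (\<phi> y)) \<and>
     (\<forall>c. \<forall>x\<in>lie_carrier L. \<phi> (lie_scale L c x) = lie_scale M c (\<phi> x))}"

definition lie_isomorphic ::
  "('k::field, 'b) lie_data \<Rightarrow> ('k, 'c) lie_data \<Rightarrow> bool" (infix \<open>\<simeq>\<^sub>L\<close> 50) where
  "L \<simeq>\<^sub>L M \<longleftrightarrow> lie_algebra L \<and> lie_algebra M \<and> lie_iso L M \<noteq> {}"

definition lie_prod ::
  "('k::field, 'b) lie_data \<Rightarrow> ('k, 'c) lie_data \<Rightarrow> ('k, 'b \<times> 'c) lie_data" (infixr \<open>\<times>\<^sub>L\<close> 80) where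
  "L \<times>\<^sub>L M =
    \<lparr> lie_carrier = lie_carrier L \<times> lie_carrier M,
      lie_add = (\<lambda>x y. (lie_add L (fst x) (fst y), lie_add M (snd x) (snd y))),
      lie_zero = (lie_zero L, lie_zero M),
      lie_scale = (\<lambda>c x. (lie_scale L c (fst x), lie_scale M c (snd x))),
      lie_bracket = (\<lambda>x y. (lie_bracket L (fst x) (fst y), lie_bracket M (snd x) (snd y))) \<rparr>"

definition abelian_line :: "('k::field, 'k) lie_data" where
  "abelian_line =
    \<lparr> lie_carrier = UNIV, lie_add = (+), lie_zero = 0, lie_scale = (*), lie_bracket = (\<lambda>_ _. 0) \<rparr>"


section \<open>Paths and monomial algebras\<close>

text \<open>
  A quiver is a directed multigraph. A path is a start vertex together with the list of its
  arrows in the order in which they are traversed, so \<open>a\<^sub>r \<cdots> a\<^sub>1\<close> (composed from right to left)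
  is \<open>(s(a\<^sub>1), [a\<^sub>1, \<dots>, a\<^sub>r])\<close>; the start vertex is needed for the trivial paths.
\<close>

type_synonym ('v, 'a) path = "'v \<times> 'a list"

definition paths :: "('v, 'a) pre_digraph \<Rightarrow> ('v, 'a) path set" where
  "paths Q = {(u, as). \<exists>v. pre_digraph.awalk Q u as v}"

definition path_src :: "('v, 'a) path \<Rightarrow> 'v" where
  "path_src p = fst p"

definition path_tgt :: "('v, 'a) pre_digraph \<Rightarrow> ('v, 'a) path \<Rightarrow> 'v" where
  "path_tgt Q p = pre_digraph.awlast Q (fst p) (snd p)"

definition path_length :: "('v, 'a) path \<Rightarrow> nat" where
  "path_length p = length (snd p)"

definition trivial_path :: "'v \<Rightarrow> ('v, 'a) path" where
  "trivial_path v = (v, [])"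

definition arrow_path :: "('v, 'a) pre_digraph \<Rightarrow> 'a \<Rightarrow> ('v, 'a) path" where
  "arrow_path Q a = (tail Q a, [a])"

definition path_comp :: "('v, 'a) path \<Rightarrow> ('v, 'a) path \<Rightarrow> ('v, 'a) path" where
  "path_comp q p = (fst p, snd p @ snd q)"

definition subpath :: "('v, 'a) pre_digraph \<Rightarrow> ('v, 'a) path \<Rightarrow> ('v, 'a) path \<Rightarrow> bool" where
  "subpath Q q p \<longleftrightarrow>
    (\<exists>xs ys. snd p = xs @ snd q @ ys \<and> fst q = path_tgt Q (fst p, xs))"

definition path_basis :: "('v, 'a) pre_digraph \<Rightarrow> ('v, 'a) path set \<Rightarrow> ('v, 'a) path set" where
  "path_basis Q Z = {p \<in> paths Q. \<forall>z\<in>Z. \<not> subpath Q z p}"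

text \<open>
  The data \<open>(Q, Z)\<close> of a finite dimensional monomial algebra \<open>kQ/I\<close>, \<open>I = \<langle>Z\<rangle>\<close>. Since
  \<open>path_basis Q Z\<close> is a basis of \<open>kQ/I\<close>, its finiteness is finite dimensionality; as \<open>I\<close> is
  generated by paths of length at least two, it is also what makes \<open>I\<close> admissible.
\<close>

locale monomial_algebra =
  fixes Q :: "('v, 'a) pre_digraph" and Z :: "('v, 'a) path set"
  assumes finite_quiver: "fin_digraph Q"
    and relations: "Z \<subseteq> {p \<in> paths Q. path_length p \<ge> 2}"
    and minimal: "\<lbrakk>z \<in> Z; z' \<in> Z; subpath Q z' z\<rbrakk> \<Longrightarrow> z' = z"
    and finite_dimensional: "finite (path_basis Q Z)"

definition length_two_paths :: "('v, 'a) pre_digraph \<Rightarrow> ('v, 'a) path set" where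
  "length_two_paths Q = {p \<in> paths Q. path_length p = 2}"

definition radical_square_zero :: "('v, 'a) pre_digraph \<Rightarrow> ('v, 'a) path set \<Rightarrow> bool" where
  "radical_square_zero Q Z \<longleftrightarrow> Z = length_two_paths Q"

text \<open>Blocks correspond to connected components of the underlying undirected graph.\<close>

definition same_block :: "('v, 'a) pre_digraph \<Rightarrow> 'a \<Rightarrow> 'a \<Rightarrow> bool" where
  "same_block Q a b \<longleftrightarrow> tail Q a \<rightarrow>\<^sup>*\<^bsub>mk_symmetric Q\<^esub> tail Q b"


section \<open>The complex computing the first Hochschild cohomology\<close>

definition parallel :: "('v, 'a) pre_digraph \<Rightarrow> ('v, 'a) path \<Rightarrow> ('v, 'a) path \<Rightarrow> bool" where
  "parallel Q p q \<longleftrightarrow> path_src p = path_src q \<and> path_tgt Q p = path_tgt Q q"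

definition parallel_pairs :: "('v, 'a) pre_digraph \<Rightarrow> ('v, 'a) path set \<Rightarrow> ('v, 'a) path set \<Rightarrow>
    (('v, 'a) path \<times> ('v, 'a) path) set" where
  "parallel_pairs Q X Y = {(p, q). p \<in> X \<and> q \<in> Y \<and> parallel Q p q}"

type_synonym ('v, 'a, 'k) cochain = "(('v, 'a) path \<times> ('v, 'a) path) \<Rightarrow>\<^sub>0 'k"

definition cochains0 ::
  "('v, 'a) pre_digraph \<Rightarrow> ('v, 'a) path set \<Rightarrow> ('v, 'a, 'k::field) cochain set" where
  "cochains0 Q Z = free_space (parallel_pairs Q (trivial_path ` verts Q) (path_basis Q Z))"

definition cochains1 ::
  "('v, 'a) pre_digraph \<Rightarrow> ('v, 'a) path set \<Rightarrow> ('v, 'a, 'k::field) cochain set" where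
  "cochains1 Q Z = free_space (parallel_pairs Q (arrow_path Q ` arcs Q) (path_basis Q Z))"

text \<open>\<open>path_pair r x\<close> is \<open>r \<parallel> x\<close>, linear in the combination of paths \<open>x\<close>.\<close>

definition path_pair ::
  "('v, 'a) path \<Rightarrow> (('v, 'a) path \<Rightarrow>\<^sub>0 'k::field) \<Rightarrow> ('v, 'a, 'k) cochain" where
  "path_pair r x = lin_ext (\<lambda>p. Poly_Mapping.single (r, p) 1) x"

text \<open>
  The path \<open>r\<close> with its arrow at position \<open>i\<close> replaced by \<open>\<gamma>\<close>. As \<open>\<gamma>\<close> is only ever substituted
  for a parallel arrow, the start vertex does not change.
\<close>

definition replace_at :: "('v, 'a) path \<Rightarrow> nat \<Rightarrow> ('v, 'a) path \<Rightarrow> ('v, 'a) path" where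
  "replace_at r i \<gamma> = (fst r, take i (snd r) @ snd \<gamma> @ drop (Suc i) (snd r))"

text \<open>\<open>r\<close> to the power \<open>a \<parallel> \<gamma>\<close>, where \<open>a\<close> is an arrow, given as a path of length one.\<close>

definition replace_sum :: "('v, 'a) pre_digraph \<Rightarrow> ('v, 'a) path set \<Rightarrow>
    ('v, 'a) path \<Rightarrow> ('v, 'a) path \<times> ('v, 'a) path \<Rightarrow> (('v, 'a) path \<Rightarrow>\<^sub>0 'k::field)" where
  "replace_sum Q Z r = (\<lambda>(a, \<gamma>).
     \<Sum>i | i < length (snd r) \<and> [snd r ! i] = snd a \<and> replace_at r i \<gamma> \<in> path_basis Q Z.
       Poly_Mapping.single (replace_at r i \<gamma>) 1)"

definition delta0 ::
  "('v, 'a) pre_digraph \<Rightarrow> ('v, 'a) path set \<Rightarrow> ('v, 'a, 'k::field) cochain \<Rightarrow> ('v, 'a, 'k) cochain"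
  where
  "delta0 Q Z = lin_ext (\<lambda>(e, \<gamma>).
     (\<Sum>a | a \<in> arcs Q \<and> tail Q a = path_src e \<and> path_comp (arrow_path Q a) \<gamma> \<in> path_basis Q Z.
        Poly_Mapping.single (arrow_path Q a, path_comp (arrow_path Q a) \<gamma>) 1)
   - (\<Sum>a | a \<in> arcs Q \<and> head Q a = path_src e \<and> path_comp \<gamma> (arrow_path Q a) \<in> path_basis Q Z.
        Poly_Mapping.single (arrow_path Q a, path_comp \<gamma> (arrow_path Q a)) 1))"

definition delta1 ::
  "('v, 'a) pre_digraph \<Rightarrow> ('v, 'a) path set \<Rightarrow> ('v, 'a, 'k::field) cochain \<Rightarrow> ('v, 'a, 'k) cochain"
  where
  "delta1 Q Z = lin_ext (\<lambda>(a, \<gamma>). \<Sum>r\<in>Z. path_pair r (replace_sum Q Z r (a, \<gamma>)))"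

definition ker_delta1 ::
  "('v, 'a) pre_digraph \<Rightarrow> ('v, 'a) path set \<Rightarrow> ('v, 'a, 'k::field) cochain set" where
  "ker_delta1 Q Z = {x \<in> cochains1 Q Z. delta1 Q Z x = 0}"

definition im_delta0 ::
  "('v, 'a) pre_digraph \<Rightarrow> ('v, 'a) path set \<Rightarrow> ('v, 'a, 'k::field) cochain set" where
  "im_delta0 Q Z = delta0 Q Z ` cochains0 Q Z"

definition cochain_bracket :: "('v, 'a) pre_digraph \<Rightarrow> ('v, 'a) path set \<Rightarrow>
    ('v, 'a, 'k::field) cochain \<Rightarrow> ('v, 'a, 'k) cochain \<Rightarrow> ('v, 'a, 'k) cochain" where
  "cochain_bracket Q Z x y = lin_ext (\<lambda>(a, \<gamma>). lin_ext (\<lambda>(b, \<epsilon>).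
      path_pair b (replace_sum Q Z \<epsilon> (a, \<gamma>)) - path_pair a (replace_sum Q Z \<gamma> (b, \<epsilon>))) y) x"

text \<open>
  The quotient of \<open>ker_delta1\<close> by \<open>im_delta0\<close>: elements are cosets, and each operation collects the
  cosets of all results on representatives, so that it involves no choice of representatives.
\<close>

definition HH1_class :: "('v, 'a) pre_digraph \<Rightarrow> ('v, 'a) path set \<Rightarrow>
    ('v, 'a, 'k::field) cochain \<Rightarrow> ('v, 'a, 'k) cochain set" where
  "HH1_class Q Z x = {x + y | y. y \<in> im_delta0 Q Z}"

definition HH1 :: "('v, 'a) pre_digraph \<Rightarrow> ('v, 'a) path set \<Rightarrow>
    ('k::field, ('v, 'a, 'k) cochain set) lie_data" where
  "HH1 Q Z =
    \<lparr> lie_carrier = HH1_class Q Z ` ker_delta1 Q Z,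
      lie_add = (\<lambda>X Y. \<Union>x\<in>X. \<Union>y\<in>Y. HH1_class Q Z (x + y)),
      lie_zero = HH1_class Q Z 0,
      lie_scale = (\<lambda>c X. \<Union>x\<in>X. HH1_class Q Z (pm_scale c x)),
      lie_bracket = (\<lambda>X Y. \<Union>x\<in>X. \<Union>y\<in>Y. HH1_class Q Z (cochain_bracket Q Z x y)) \<rparr>"


section \<open>Gluing two arrows\<close>

text \<open>
  The quotient quiver in which \<open>\<alpha>\<close> is identified with \<open>\<beta>\<close>, the source of \<open>\<alpha>\<close> with the source of \<open>\<beta>\<close>
  and the target of \<open>\<alpha>\<close> with the target of \<open>\<beta>\<close>. The classes are represented by \<open>\<alpha>\<close> and its end
  points, so that \<open>\<gamma>\<^sup>*\<close>, \<open>f\<^sub>1\<close>, \<open>f\<^sub>2\<close> are \<open>\<alpha>\<close>, \<open>tail Q \<alpha>\<close>, \<open>head Q \<alpha>\<close>.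
\<close>

definition glue_arrow :: "'a \<Rightarrow> 'a \<Rightarrow> 'a \<Rightarrow> 'a" where
  "glue_arrow \<alpha> \<beta> a = (if a = \<beta> then \<alpha> else a)"

definition glue_vertex :: "('v, 'a) pre_digraph \<Rightarrow> 'a \<Rightarrow> 'a \<Rightarrow> 'v \<Rightarrow> 'v" where
  "glue_vertex Q \<alpha> \<beta> v =
    (if v = tail Q \<beta> then tail Q \<alpha> else if v = head Q \<beta> then head Q \<alpha> else v)"

definition glue_quiver :: "('v, 'a) pre_digraph \<Rightarrow> 'a \<Rightarrow> 'a \<Rightarrow> ('v, 'a) pre_digraph" where
  "glue_quiver Q \<alpha> \<beta> =
    \<lparr> verts = glue_vertex Q \<alpha> \<beta> ` verts Q,
      arcs = glue_arrow \<alpha> \<beta> ` arcs Q,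
      tail = (\<lambda>a. glue_vertex Q \<alpha> \<beta> (tail Q a)),
      head = (\<lambda>a. glue_vertex Q \<alpha> \<beta> (head Q a)) \<rparr>"

definition glue_path ::
  "('v, 'a) pre_digraph \<Rightarrow> 'a \<Rightarrow> 'a \<Rightarrow> ('v, 'a) path \<Rightarrow> ('v, 'a) path" where
  "glue_path Q \<alpha> \<beta> p = (glue_vertex Q \<alpha> \<beta> (fst p), map (glue_arrow \<alpha> \<beta>) (snd p))"

definition special_pairs ::
  "('v, 'a) pre_digraph \<Rightarrow> ('v, 'a) path set \<Rightarrow> 'a \<Rightarrow> 'a \<Rightarrow> ('a \<times> ('v, 'a) path) set" where
  "special_pairs Q Z \<alpha> \<beta> = {(a, p).
     a \<in> arcs Q \<and> p \<in> path_basis Q Z \<and>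
     {tail Q a, head Q a} \<inter> {tail Q \<alpha>, head Q \<alpha>, tail Q \<beta>, head Q \<beta>} \<noteq> {} \<and>
     \<not> parallel Q (arrow_path Q a) p \<and>
     parallel (glue_quiver Q \<alpha> \<beta>) (glue_path Q \<alpha> \<beta> (arrow_path Q a)) (glue_path Q \<alpha> \<beta> p) \<and>
     (glue_path Q \<alpha> \<beta> (arrow_path Q a), glue_path Q \<alpha> \<beta> p) \<noteq>
       (glue_path Q \<alpha> \<beta> (arrow_path Q \<alpha>), glue_path Q \<alpha> \<beta> (arrow_path Q \<alpha>)) \<and>
     (a = \<alpha> \<longrightarrow> \<not> parallel Q p (arrow_path Q \<beta>)) \<and>
     (a = \<beta> \<longrightarrow> \<not> parallel Q p (arrow_path Q \<alpha>)) \<and>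
     (p = arrow_path Q \<alpha> \<longrightarrow> \<not> parallel Q (arrow_path Q a) (arrow_path Q \<beta>)) \<and>
     (p = arrow_path Q \<beta> \<longrightarrow> \<not> parallel Q (arrow_path Q a) (arrow_path Q \<alpha>))}"

text \<open>
  \<open>Z\<^sub>s\<^sub>p\<^sub>p\<close>, where \<open>Z\<close> and \<open>Z'\<close> are the relations of the original and of the glued algebra.
\<close>

definition Z_spp :: "('v, 'a) pre_digraph \<Rightarrow> ('v, 'a) path set \<Rightarrow> ('v, 'a) path set \<Rightarrow> 'a \<Rightarrow> 'a \<Rightarrow>
    ('v, 'a, 'k::field) cochain set" where
  "Z_spp Q Z Z' \<alpha> \<beta> =
     module.span pm_scale
       ((\<lambda>(a, p). Poly_Mapping.single (glue_path Q \<alpha> \<beta> (arrow_path Q a), glue_path Q \<alpha> \<beta> p) 1)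
          ` special_pairs Q Z \<alpha> \<beta>)
     \<inter> ker_delta1 (glue_quiver Q \<alpha> \<beta>) Z'"

section \<open>The glued algebra as a subalgebra\<close>

text \<open>
  The multiplication of \<open>kQ/I\<close> on the basis of paths, the generators \<open>f\<^sub>i\<close>, \<open>\<gamma>\<^sup>*\<close>, \<open>\<gamma>\<^sub>j\<^sup>*\<close> and the
  subalgebra they generate. The unit of \<open>kQ/I\<close> is the sum of the \<open>f\<^sub>i\<close>.
\<close>

definition path_mult :: "('v, 'a) pre_digraph \<Rightarrow> ('v, 'a) path set \<Rightarrow>
    ('v, 'a) path \<Rightarrow> ('v, 'a) path \<Rightarrow> (('v, 'a) path \<Rightarrow>\<^sub>0 'k::field)" where
  "path_mult Q Z q p =
    (if path_src q = path_tgt Q p \<and> path_comp q p \<in> path_basis Q Z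
     then Poly_Mapping.single (path_comp q p) 1 else 0)"

definition alg_mult :: "('v, 'a) pre_digraph \<Rightarrow> ('v, 'a) path set \<Rightarrow>
    (('v, 'a) path \<Rightarrow>\<^sub>0 'k::field) \<Rightarrow> (('v, 'a) path \<Rightarrow>\<^sub>0 'k) \<Rightarrow> (('v, 'a) path \<Rightarrow>\<^sub>0 'k)" where
  "alg_mult Q Z x y = lin_ext (\<lambda>q. lin_ext (\<lambda>p. path_mult Q Z q p) y) x"

abbreviation basis_vec :: "'b \<Rightarrow> ('b \<Rightarrow>\<^sub>0 'k::field)" where
  "basis_vec p \<equiv> Poly_Mapping.single p 1"

definition glue_generators ::
  "('v, 'a) pre_digraph \<Rightarrow> 'a \<Rightarrow> 'a \<Rightarrow> (('v, 'a) path \<Rightarrow>\<^sub>0 'k::field) set" where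
  "glue_generators Q \<alpha> \<beta> =
     {basis_vec (trivial_path (tail Q \<alpha>)) + basis_vec (trivial_path (tail Q \<beta>)),
      basis_vec (trivial_path (head Q \<alpha>)) + basis_vec (trivial_path (head Q \<beta>)),
      basis_vec (arrow_path Q \<alpha>) + basis_vec (arrow_path Q \<beta>)}
     \<union> (\<lambda>v. basis_vec (trivial_path v)) `
         (verts Q - {tail Q \<alpha>, tail Q \<beta>, head Q \<alpha>, head Q \<beta>})
     \<union> (\<lambda>a. basis_vec (arrow_path Q a)) ` (arcs Q - {\<alpha>, \<beta>})"

definition glued_algebra :: "('v, 'a) pre_digraph \<Rightarrow> ('v, 'a) path set \<Rightarrow> 'a \<Rightarrow> 'a \<Rightarrow>
    (('v, 'a) path \<Rightarrow>\<^sub>0 'k::field) set" where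
  "glued_algebra Q Z \<alpha> \<beta> =
     \<Inter>{S. module.subspace pm_scale S \<and> glue_generators Q \<alpha> \<beta> \<subseteq> S \<and>
         (\<forall>x\<in>S. \<forall>y\<in>S. alg_mult Q Z x y \<in> S)}"

lemma lin_ext_cong_sum:
  assumes "finite S" "Poly_Mapping.keys f \<subseteq> S"
  shows "lin_ext g f = (\<Sum>x\<in>S. pm_scale (Poly_Mapping.lookup f x) (g x))"
  unfolding lin_ext_def using assms
  by (intro sum.mono_neutral_left) (auto intro!: poly_mapping_eqI simp: in_keys_iff)

lemma lin_ext_single [simp]: "lin_ext g (basis_vec x) = g x"
  by (auto simp: lin_ext_def intro!: poly_mapping_eqI)

lemma lin_ext_add: "lin_ext g (x + y) = lin_ext g x + lin_ext g y"
proof -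
  let ?S = "Poly_Mapping.keys x \<union> Poly_Mapping.keys y"
  have "finite ?S" by simp
  note c = lin_ext_cong_sum[OF this, of _ g]
  have "Poly_Mapping.keys (x + y) \<subseteq> ?S" by (rule Poly_Mapping.keys_add)
  then show ?thesis
    by (subst c, simp, subst c, simp, subst c, simp)
       (auto intro!: poly_mapping_eqI simp: lookup_sum lookup_add sum.distrib algebra_simps)
qed

lemma lin_ext_scale: "lin_ext g (pm_scale c x) = pm_scale c (lin_ext g x)"
proof -
  have "Poly_Mapping.keys (pm_scale c x) \<subseteq> Poly_Mapping.keys x"
    by (auto simp: in_keys_iff)
  then show ?thesis
    by (subst lin_ext_cong_sum[OF finite_keys])
       (auto intro!: poly_mapping_eqI simp: lookup_sum lin_ext_def sum_distrib_left mult.assoc)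
qed

lemma lin_ext_0 [simp]: "lin_ext g 0 = 0"
  by (simp add: lin_ext_def)

lemma lin_ext_sum: "lin_ext g (sum h S) = (\<Sum>s\<in>S. lin_ext g (h s))"
  by (induction S rule: infinite_finite_induct) (auto simp: lin_ext_add)

lemma pm_scale_sum: "pm_scale c (sum h S) = (\<Sum>s\<in>S. pm_scale c (h s))"
  by (auto intro!: poly_mapping_eqI simp: lookup_sum sum_distrib_left)

lemma lin_ext_fun_sum: "lin_ext (\<lambda>x. \<Sum>s\<in>S. g s x) f = (\<Sum>s\<in>S. lin_ext (g s) f)"
  unfolding lin_ext_def pm_scale_sum by (rule sum.swap)

lemma lin_ext_comp: "lin_ext h (lin_ext g f) = lin_ext (\<lambda>x. lin_ext h (g x)) f"
  by (simp add: lin_ext_def[of g] lin_ext_def[of "\<lambda>x. lin_ext h (g x)"] lin_ext_sum lin_ext_scale)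

lemma lin_ext_swap:
  "lin_ext (\<lambda>q. lin_ext (\<lambda>p. g q p) y) x = lin_ext (\<lambda>p. lin_ext (\<lambda>q. g q p) x) y"
proof -
  have "lin_ext (\<lambda>q. lin_ext (\<lambda>p. g q p) y) x
      = (\<Sum>q\<in>Poly_Mapping.keys x. \<Sum>p\<in>Poly_Mapping.keys y.
          pm_scale (Poly_Mapping.lookup x q * Poly_Mapping.lookup y p) (g q p))"
    unfolding lin_ext_def pm_scale_sum
    by (intro sum.cong refl) (auto intro!: poly_mapping_eqI)
  also have "\<dots> = (\<Sum>p\<in>Poly_Mapping.keys y. \<Sum>q\<in>Poly_Mapping.keys x.
          pm_scale (Poly_Mapping.lookup x q * Poly_Mapping.lookup y p) (g q p))"
    by (rule sum.swap)
  also have "\<dots> = lin_ext (\<lambda>p. lin_ext (\<lambda>q. g q p) x) y"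
    unfolding lin_ext_def pm_scale_sum
    by (intro sum.cong refl) (auto intro!: poly_mapping_eqI)
  finally show ?thesis .
qed

lemma alg_mult_lin_ext:
  "alg_mult Q Z (lin_ext g x) (lin_ext h y)
    = lin_ext (\<lambda>q. lin_ext (\<lambda>p. alg_mult Q Z (g q) (h p)) y) x"
  unfolding alg_mult_def lin_ext_comp
  by (rule arg_cong[where f = "\<lambda>G. lin_ext G x"], rule ext)
     (simp add: lin_ext_comp lin_ext_swap[of _ y])

lemma path_ends [simp]:
  "path_src (trivial_path v) = v" "path_tgt Q (trivial_path v) = v"
  "path_src (arrow_path Q a) = tail Q a" "path_tgt Q (arrow_path Q a) = head Q a"
  by (simp_all add: path_src_def path_tgt_def trivial_path_def arrow_path_def
      pre_digraph.awalk_verts.simps)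

lemma path_eqs [simp]:
  "trivial_path v = trivial_path w \<longleftrightarrow> v = w" "trivial_path v \<noteq> arrow_path Q a"
  "arrow_path Q a \<noteq> trivial_path v" "arrow_path Q a = arrow_path Q b \<longleftrightarrow> a = b"
  by (auto simp: trivial_path_def arrow_path_def)

lemma path_comp_trivial [simp]:
  "path_comp (trivial_path v) p = p" "path_comp (arrow_path Q a) (trivial_path (tail Q a)) = arrow_path Q a"
  by (simp_all add: path_comp_def trivial_path_def arrow_path_def)

lemma path_basis_rad_square_zero:
  assumes "wf_digraph Q" "radical_square_zero Q Z"
  shows "path_basis Q Z = trivial_path ` verts Q \<union> arrow_path Q ` arcs Q"
proof -
  interpret wf_digraph Q by fact
  have Z: "Z = length_two_paths Q" using assms(2) by (simp add: radical_square_zero_def)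
  have long: "(u, a # b # cs) \<notin> path_basis Q Z" for u a b cs
  proof
    assume that: "(u, a # b # cs) \<in> path_basis Q Z"
    have "(u, [a, b]) \<in> length_two_paths Q"
      using that
      by (auto simp: path_basis_def paths_def awalk_def length_two_paths_def path_length_def)
    moreover have "subpath Q (u, [a, b]) (u, a # b # cs)"
      unfolding subpath_def
      by (rule exI[of _ "[]"], rule exI[of _ cs]) (simp add: path_tgt_def)
    ultimately show False using that Z by (auto simp: path_basis_def)
  qed
  have short: "\<not> subpath Q z (u, as)" if "z \<in> Z" "length as < 2" for z u as
    using that by (auto simp: Z length_two_paths_def path_length_def subpath_def)
  have triv: "(u, []) \<in> path_basis Q Z \<longleftrightarrow> u \<in> verts Q" for u
    using short[of _ "[]" u] by (auto simp: path_basis_def paths_def awalk_def)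
  have arr: "(u, [a]) \<in> path_basis Q Z \<longleftrightarrow> a \<in> arcs Q \<and> u = tail Q a" for u a
    using short[of _ "[a]" u] by (auto simp: path_basis_def paths_def awalk_def)
  show ?thesis
  proof (rule set_eqI)
    fix p :: "('a, 'b) path"
    obtain u as where p: "p = (u, as)" by (cases p)
    show "p \<in> path_basis Q Z \<longleftrightarrow> p \<in> trivial_path ` verts Q \<union> arrow_path Q ` arcs Q"
    proof (cases as rule: remdups_adj.cases)
      case 1
      then show ?thesis by (auto simp: p triv trivial_path_def arrow_path_def)
    next
      case (2 a)
      then show ?thesis by (auto simp: p arr trivial_path_def arrow_path_def)
    next
      case (3 a b cs)
      then show ?thesis by (auto simp: p long trivial_path_def arrow_path_def)
    qed
  qed
qed

text \<open>
  For a radical square zero algebra, the algebra given by the glued quiver and all its paths of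
  length two is the subalgebra above: its basis path \<open>p\<close> is the sum of the paths glued to \<open>p\<close>.
\<close>

definition unglue :: "('v, 'a) pre_digraph \<Rightarrow> ('v, 'a) path set \<Rightarrow> 'a \<Rightarrow> 'a \<Rightarrow>
    (('v, 'a) path \<Rightarrow>\<^sub>0 'k::field) \<Rightarrow> (('v, 'a) path \<Rightarrow>\<^sub>0 'k)" where
  "unglue Q Z \<alpha> \<beta> =
     lin_ext (\<lambda>p. \<Sum>q | q \<in> path_basis Q Z \<and> glue_path Q \<alpha> \<beta> q = p. basis_vec q)"

context
  fixes Q :: "('v, 'a) pre_digraph" and Z Z' :: "('v, 'a) path set" and \<alpha> \<beta> :: 'a
  assumes fin: "fin_digraph Q" and rsz: "radical_square_zero Q Z"
    and arcs: "\<alpha> \<in> arcs Q" "\<beta> \<in> arcs Q"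
    and dist: "distinct [tail Q \<alpha>, head Q \<alpha>, tail Q \<beta>, head Q \<beta>]"
    and rsz': "radical_square_zero (glue_quiver Q \<alpha> \<beta>) Z'"
begin

interpretation fin_digraph Q by (fact fin)

private abbreviation (input) "Q' \<equiv> glue_quiver Q \<alpha> \<beta>"
private abbreviation (input) "gv \<equiv> glue_vertex Q \<alpha> \<beta>"
private abbreviation (input) "ga \<equiv> glue_arrow \<alpha> \<beta>"
private abbreviation (input) "gp \<equiv> glue_path Q \<alpha> \<beta>"
private abbreviation (input) "fib p \<equiv> {q. q \<in> path_basis Q Z \<and> gp q = p}"

private lemma tail_ga: "gv (tail Q (ga a)) = gv (tail Q a)"
  and head_ga: "gv (head Q (ga a)) = gv (head Q a)"
  using dist by (auto simp: glue_vertex_def glue_arrow_def)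

private lemma wf': "wf_digraph Q'"
  by unfold_locales (auto simp: glue_quiver_def tail_ga head_ga)

private lemma basis: "path_basis Q Z = trivial_path ` verts Q \<union> arrow_path Q ` arcs Q"
  by (rule path_basis_rad_square_zero) (unfold_locales, rule rsz)

private lemma basis': "path_basis Q' Z' = trivial_path ` verts Q' \<union> arrow_path Q' ` arcs Q'"
  by (rule path_basis_rad_square_zero[OF wf' rsz'])

private lemma gp_trivial: "gp (trivial_path v) = trivial_path (gv v)"
  by (simp add: glue_path_def trivial_path_def)

private lemma gp_arrow: "gp (arrow_path Q a) = arrow_path Q' (ga a)"
  by (simp add: glue_path_def arrow_path_def glue_quiver_def tail_ga)

private lemma gp_basis: "gp ` path_basis Q Z = path_basis Q' Z'"
  by (simp add: basis basis' image_Un image_image gp_trivial gp_arrow) (simp add: glue_quiver_def image_image)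

private lemma finite_basis: "finite (path_basis Q Z)"
  by (simp add: basis)

private lemma tgt:
  assumes "p \<in> path_basis Q Z"
  shows "path_tgt Q p \<in> verts Q" "path_tgt Q' (gp p) = gv (path_tgt Q p)"
    "path_src p \<in> verts Q" "path_src (gp p) = gv (path_src p)"
  using assms
  by (auto simp: basis gp_trivial gp_arrow) (simp_all add: glue_quiver_def head_ga tail_ga)

private lemma finite_fib: "finite (fib p)"
  using finite_basis by simp

private lemma lookup_unglue:
  "Poly_Mapping.lookup (unglue Q Z \<alpha> \<beta> x) q =
     (if q \<in> path_basis Q Z then Poly_Mapping.lookup x (gp q) else 0)"
proof -
  have "Poly_Mapping.lookup (unglue Q Z \<alpha> \<beta> x) q =
     (\<Sum>p\<in>Poly_Mapping.keys x. Poly_Mapping.lookup x p *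
        (\<Sum>q'\<in>fib p. Poly_Mapping.lookup (basis_vec q') q))"
    by (simp add: unglue_def lin_ext_def lookup_sum)
  also have "\<dots> = (\<Sum>p\<in>Poly_Mapping.keys x. Poly_Mapping.lookup x p * (if q \<in> fib p then 1 else 0))"
    by (intro sum.cong refl arg_cong2[where f = "(*)"])
       (simp add: lookup_single when_def finite_fib del: mem_Collect_eq)
  also have "\<dots> = (\<Sum>p\<in>Poly_Mapping.keys x.
      if p = gp q then (if q \<in> path_basis Q Z then Poly_Mapping.lookup x (gp q) else 0) else 0)"
    by (intro sum.cong refl) auto
  also have "\<dots> = (if q \<in> path_basis Q Z then Poly_Mapping.lookup x (gp q) else 0)"
    by (simp add: in_keys_iff)
  finally show ?thesis .
qed

private lemma mult_trivial_left:
  assumes "p \<in> path_basis Q Z"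
  shows "(\<Sum>q\<in>fib (trivial_path f). path_mult Q Z q p)
      = (if gv (path_tgt Q p) = f then basis_vec p else (0 :: _ \<Rightarrow>\<^sub>0 'k::field))"
proof -
  have "(\<Sum>q\<in>fib (trivial_path f). path_mult Q Z q p)
      = (\<Sum>q\<in>fib (trivial_path f). if q = trivial_path (path_tgt Q p) then basis_vec p else (0 :: _ \<Rightarrow>\<^sub>0 'k))"
    using assms by (intro sum.cong refl)
      (auto simp: path_mult_def basis gp_trivial gp_arrow)
  also have "\<dots> = (if trivial_path (path_tgt Q p) \<in> fib (trivial_path f) then basis_vec p else 0)"
    by (simp add: finite_fib del: mem_Collect_eq)
  also have "trivial_path (path_tgt Q p) \<in> fib (trivial_path f) \<longleftrightarrow> gv (path_tgt Q p) = f"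
    using tgt(1)[OF assms] by (auto simp: basis gp_trivial)
  finally show ?thesis .
qed

private lemma mult_trivial_right:
  assumes "q \<in> path_basis Q Z"
  shows "(\<Sum>p\<in>fib (trivial_path f). path_mult Q Z q p)
      = (if gv (path_src q) = f then basis_vec q else (0 :: _ \<Rightarrow>\<^sub>0 'k::field))"
proof -
  have "(\<Sum>p\<in>fib (trivial_path f). path_mult Q Z q p)
      = (\<Sum>p\<in>fib (trivial_path f). if p = trivial_path (path_src q) then basis_vec q else (0 :: _ \<Rightarrow>\<^sub>0 'k))"
    using assms by (intro sum.cong refl)
      (auto simp: path_mult_def basis gp_trivial gp_arrow)
  also have "\<dots> = (if trivial_path (path_src q) \<in> fib (trivial_path f) then basis_vec q else 0)"
    by (simp add: finite_fib del: mem_Collect_eq)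
  also have "trivial_path (path_src q) \<in> fib (trivial_path f) \<longleftrightarrow> gv (path_src q) = f"
    using tgt(3)[OF assms] by (auto simp: basis gp_trivial)
  finally show ?thesis .
qed

private lemma unglue_basis: "unglue Q Z \<alpha> \<beta> (basis_vec p) = (\<Sum>q\<in>fib p. basis_vec q)"
  by (simp add: unglue_def)

private lemma alg_mult_sums:
  "alg_mult Q Z (\<Sum>q\<in>A. basis_vec q) (\<Sum>p\<in>B. basis_vec p) = (\<Sum>q\<in>A. \<Sum>p\<in>B. path_mult Q Z q p)"
  by (simp add: alg_mult_def lin_ext_sum)

private lemma unglue_path_mult:
  assumes q: "q \<in> path_basis Q' Z'" and p: "p \<in> path_basis Q' Z'"
  shows "unglue Q Z \<alpha> \<beta> (path_mult Q' Z' q p)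
    = alg_mult Q Z (unglue Q Z \<alpha> \<beta> (basis_vec q)) (unglue Q Z \<alpha> \<beta> (basis_vec p) :: _ \<Rightarrow>\<^sub>0 'k::field)"
proof -
  consider (l) f where "q = trivial_path f" | (r) f where "p = trivial_path f"
    | (arr) a b where "q = arrow_path Q' a" "p = arrow_path Q' b"
    using p q by (auto simp: basis')
  then show ?thesis
  proof cases
    case l
    have comp: "path_comp q p = p" by (simp add: l path_comp_def trivial_path_def)
    have "alg_mult Q Z (unglue Q Z \<alpha> \<beta> (basis_vec q)) (unglue Q Z \<alpha> \<beta> (basis_vec p) :: _ \<Rightarrow>\<^sub>0 'k)
        = (\<Sum>p'\<in>fib p. \<Sum>q'\<in>fib q. path_mult Q Z q' p')"
      unfolding unglue_basis alg_mult_sums by (rule sum.swap)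
    also have "\<dots> = (\<Sum>p'\<in>fib p. if gv (path_tgt Q p') = f then basis_vec p' else 0)"
      unfolding l by (intro sum.cong refl mult_trivial_left) auto
    also have "\<dots> = (\<Sum>p'\<in>fib p. if path_tgt Q' p = f then basis_vec p' else 0)"
      by (intro sum.cong refl) (auto simp: tgt)
    also have "\<dots> = (if path_src q = path_tgt Q' p then \<Sum>p'\<in>fib p. basis_vec p' else 0)"
      by (auto simp: l)
    also have "\<dots> = unglue Q Z \<alpha> \<beta> (path_mult Q' Z' q p)"
      using p by (auto simp: path_mult_def comp unglue_basis) (simp add: unglue_def)
    finally show ?thesis by simp
  next
    case r
    have comp: "path_comp q p = q" if "path_src q = path_tgt Q' p"
      using that by (cases q) (simp add: r path_comp_def, simp add: trivial_path_def path_src_def)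
    have "alg_mult Q Z (unglue Q Z \<alpha> \<beta> (basis_vec q)) (unglue Q Z \<alpha> \<beta> (basis_vec p) :: _ \<Rightarrow>\<^sub>0 'k)
        = (\<Sum>q'\<in>fib q. \<Sum>p'\<in>fib p. path_mult Q Z q' p')"
      unfolding unglue_basis alg_mult_sums ..
    also have "\<dots> = (\<Sum>q'\<in>fib q. if gv (path_src q') = f then basis_vec q' else 0)"
      unfolding r by (intro sum.cong refl mult_trivial_right) auto
    also have "\<dots> = (\<Sum>q'\<in>fib q. if path_src q = f then basis_vec q' else 0)"
      by (intro sum.cong refl) (auto simp: tgt)
    also have "\<dots> = (if path_src q = path_tgt Q' p then \<Sum>q'\<in>fib q. basis_vec q' else 0)"
      by (auto simp: r)
    also have "\<dots> = unglue Q Z \<alpha> \<beta> (path_mult Q' Z' q p)"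
      using q by (auto simp: path_mult_def comp unglue_basis) (simp add: unglue_def)
    finally show ?thesis by simp
  next
    case arr
    have "path_comp q p \<notin> path_basis Q' Z'"
      by (auto simp: arr basis' path_comp_def arrow_path_def trivial_path_def)
    then have "path_mult Q' Z' q p = (0 :: _ \<Rightarrow>\<^sub>0 'k)"
      by (simp add: path_mult_def)
    moreover have "path_mult Q Z q' p' = (0 :: _ \<Rightarrow>\<^sub>0 'k)" if "q' \<in> fib q" "p' \<in> fib p" for q' p'
    proof -
      have "length (snd q') = 1" "length (snd p') = 1"
        using that by (auto simp: arr glue_path_def arrow_path_def)
      then have "path_comp q' p' \<notin> path_basis Q Z"
        by (auto simp: basis path_comp_def arrow_path_def trivial_path_def dest: arg_cong[where f = length])
      then show ?thesis by (simp add: path_mult_def)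
    qed
    ultimately show ?thesis
      by (simp add: unglue_basis alg_mult_sums) (simp add: unglue_def)
  qed
qed

lemma unglue_add: "unglue Q Z \<alpha> \<beta> (x + y) = unglue Q Z \<alpha> \<beta> x + unglue Q Z \<alpha> \<beta> y"
  by (simp add: unglue_def lin_ext_add)

lemma unglue_scale: "unglue Q Z \<alpha> \<beta> (pm_scale c x) = pm_scale c (unglue Q Z \<alpha> \<beta> x)"
  by (simp add: unglue_def lin_ext_scale)

lemma unglue_mult:
  assumes "x \<in> free_space (path_basis Q' Z')" "y \<in> free_space (path_basis Q' Z')"
  shows "unglue Q Z \<alpha> \<beta> (alg_mult Q' Z' x y)
    = alg_mult Q Z (unglue Q Z \<alpha> \<beta> x) (unglue Q Z \<alpha> \<beta> y :: _ \<Rightarrow>\<^sub>0 'k::field)"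
proof -
  have "unglue Q Z \<alpha> \<beta> (alg_mult Q' Z' x y)
      = lin_ext (\<lambda>q. lin_ext (\<lambda>p. unglue Q Z \<alpha> \<beta> (path_mult Q' Z' q p)) y) x"
    by (simp add: unglue_def alg_mult_def lin_ext_comp)
  also have "\<dots> = lin_ext (\<lambda>q. lin_ext (\<lambda>p.
      alg_mult Q Z (unglue Q Z \<alpha> \<beta> (basis_vec q)) (unglue Q Z \<alpha> \<beta> (basis_vec p))) y) x"
    using assms unfolding lin_ext_def free_space_def
    by (intro sum.cong refl arg_cong2[where f = pm_scale] unglue_path_mult) auto
  also have "\<dots> = alg_mult Q Z (unglue Q Z \<alpha> \<beta> x) (unglue Q Z \<alpha> \<beta> y)"
    by (simp add: unglue_def alg_mult_lin_ext)
  finally show ?thesis .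
qed

lemma unglue_inj: "inj_on (unglue Q Z \<alpha> \<beta>) (free_space (path_basis Q' Z'))"
proof (rule inj_onI, rule poly_mapping_eqI)
  fix x y :: "('v, 'a) path \<Rightarrow>\<^sub>0 'k::field" and p
  assume xy: "x \<in> free_space (path_basis Q' Z')" "y \<in> free_space (path_basis Q' Z')"
    and eq: "unglue Q Z \<alpha> \<beta> x = unglue Q Z \<alpha> \<beta> y"
  show "Poly_Mapping.lookup x p = Poly_Mapping.lookup y p"
  proof (cases "p \<in> path_basis Q' Z'")
    case True
    then obtain q where "q \<in> path_basis Q Z" "p = gp q" using gp_basis by blast
    then show ?thesis
      using arg_cong[OF eq, of "\<lambda>z. Poly_Mapping.lookup z q"] by (simp add: lookup_unglue)
  next
    case False
    then have "p \<notin> Poly_Mapping.keys x" "p \<notin> Poly_Mapping.keys y"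
      using xy by (auto simp: free_space_def)
    then show ?thesis by (simp add: in_keys_iff)
  qed
qed

private lemma fib_f1: "fib (trivial_path (tail Q \<alpha>)) = {trivial_path (tail Q \<alpha>), trivial_path (tail Q \<beta>)}"
  and fib_f2: "fib (trivial_path (head Q \<alpha>)) = {trivial_path (head Q \<alpha>), trivial_path (head Q \<beta>)}"
  and fib_f: "v \<in> verts Q - {tail Q \<alpha>, tail Q \<beta>, head Q \<alpha>, head Q \<beta>} \<Longrightarrow>
    fib (trivial_path v) = {trivial_path v}"
  using dist arcs
  by (auto simp: basis gp_trivial gp_arrow glue_vertex_def split: if_splits)

private lemma fib_g: "fib (arrow_path Q' \<alpha>) = {arrow_path Q \<alpha>, arrow_path Q \<beta>}"
  and fib_g': "a \<in> arcs Q - {\<alpha>, \<beta>} \<Longrightarrow> fib (arrow_path Q' a) = {arrow_path Q a}"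
  using arcs
  by (auto simp: basis gp_trivial gp_arrow glue_arrow_def split: if_splits)

private lemma verts': "verts Q' = {tail Q \<alpha>, head Q \<alpha>} \<union> (verts Q - {tail Q \<alpha>, tail Q \<beta>, head Q \<alpha>, head Q \<beta>})"
  using dist arcs by (auto simp: glue_quiver_def glue_vertex_def image_iff)

private lemma arcs': "arcs Q' = {\<alpha>} \<union> (arcs Q - {\<alpha>, \<beta>})"
  using arcs by (auto simp: glue_quiver_def glue_arrow_def image_iff)

lemma unglue_generators:
  "(\<lambda>p. unglue Q Z \<alpha> \<beta> (basis_vec p)) ` path_basis Q' Z'
    = (glue_generators Q \<alpha> \<beta> :: (('v, 'a) path \<Rightarrow>\<^sub>0 'k::field) set)"
proof -
  let ?u = "\<lambda>p. unglue Q Z \<alpha> \<beta> (basis_vec p) :: ('v, 'a) path \<Rightarrow>\<^sub>0 'k"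
  have d: "trivial_path (tail Q \<alpha>) \<noteq> trivial_path (tail Q \<beta>)"
    "trivial_path (head Q \<alpha>) \<noteq> trivial_path (head Q \<beta>)" "arrow_path Q \<alpha> \<noteq> arrow_path Q \<beta>"
    using dist by (auto simp: trivial_path_def arrow_path_def)
  have "(\<lambda>v. ?u (trivial_path v))
          ` (verts Q - {tail Q \<alpha>, tail Q \<beta>, head Q \<alpha>, head Q \<beta>})
      = (\<lambda>v. basis_vec (trivial_path v)) ` (verts Q - {tail Q \<alpha>, tail Q \<beta>, head Q \<alpha>, head Q \<beta>})"
    by (intro image_cong refl) (simp only: unglue_basis fib_f, simp)
  moreover have "(\<lambda>a. ?u (arrow_path Q' a)) ` (arcs Q - {\<alpha>, \<beta>})
      = (\<lambda>a. basis_vec (arrow_path Q a)) ` (arcs Q - {\<alpha>, \<beta>})"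
    by (intro image_cong refl) (simp only: unglue_basis fib_g', simp)
  moreover have "?u (trivial_path (tail Q \<alpha>))
      = basis_vec (trivial_path (tail Q \<alpha>)) + basis_vec (trivial_path (tail Q \<beta>))"
    using d by (simp only: unglue_basis fib_f1) simp
  moreover have "?u (trivial_path (head Q \<alpha>))
      = basis_vec (trivial_path (head Q \<alpha>)) + basis_vec (trivial_path (head Q \<beta>))"
    using d by (simp only: unglue_basis fib_f2) simp
  moreover have "?u (arrow_path Q' \<alpha>)
      = basis_vec (arrow_path Q \<alpha>) + basis_vec (arrow_path Q \<beta>)"
    using d by (simp only: unglue_basis fib_g) simp
  ultimately show ?thesis
    unfolding basis' verts' arcs' image_Un image_image glue_generators_def
    by (simp add: insert_commute)
qed

lemma unglue_image:
  "unglue Q Z \<alpha> \<beta> ` free_space (path_basis Q' Z')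
    = (glued_algebra Q Z \<alpha> \<beta> :: (('v, 'a) path \<Rightarrow>\<^sub>0 'k::field) set)"
proof -
  interpret vector_space "pm_scale :: 'k \<Rightarrow> (('v, 'a) path \<Rightarrow>\<^sub>0 'k) \<Rightarrow> _"
    by (rule vector_space_pm_scale)
  let ?F = "free_space (path_basis Q' Z') :: (('v, 'a) path \<Rightarrow>\<^sub>0 'k) set"
  let ?I = "unglue Q Z \<alpha> \<beta> ` ?F"
  have subF: "subspace ?F"
    unfolding subspace_def free_space_def
    by (auto simp: in_keys_iff subset_iff lookup_add) (metis add_0)
  have vecF: "basis_vec p \<in> ?F" if "p \<in> path_basis Q' Z'" for p
    using that by (simp add: free_space_def)
  have multF: "alg_mult Q' Z' x y \<in> ?F" for x y
  proof -
    have "path_mult Q' Z' q p \<in> ?F" for q p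
      by (auto simp: path_mult_def free_space_def)
    then show ?thesis
      unfolding alg_mult_def lin_ext_def
      by (intro subspace_sum[OF subF] subspace_scale[OF subF])
  qed
  have "subspace ?I"
  proof (rule subspaceI)
    show "0 \<in> ?I"
      using subspace_0[OF subF] by (auto intro!: image_eqI[of _ _ 0] simp: unglue_def)
    show "x + y \<in> ?I" if "x \<in> ?I" "y \<in> ?I" for x y
      using that subspace_add[OF subF] by (auto simp: unglue_add[symmetric])
    show "pm_scale c x \<in> ?I" if "x \<in> ?I" for c x
      using that subspace_scale[OF subF] by (auto simp: unglue_scale[symmetric])
  qed
  moreover have "glue_generators Q \<alpha> \<beta> \<subseteq> ?I"
    using vecF by (auto simp: unglue_generators[symmetric])
  moreover have "alg_mult Q Z x y \<in> ?I" if "x \<in> ?I" "y \<in> ?I" for x y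
    using that multF by (auto simp: unglue_mult[symmetric])
  ultimately have "glued_algebra Q Z \<alpha> \<beta> \<subseteq> ?I"
    unfolding glued_algebra_def by blast
  moreover have "?I \<subseteq> S" if S: "subspace S" "glue_generators Q \<alpha> \<beta> \<subseteq> S" for S
  proof
    fix z assume "z \<in> ?I"
    then obtain x where x: "x \<in> ?F" "z = unglue Q Z \<alpha> \<beta> x" by blast
    have "z = (\<Sum>p\<in>Poly_Mapping.keys x. pm_scale (Poly_Mapping.lookup x p) (unglue Q Z \<alpha> \<beta> (basis_vec p)))"
      by (simp add: x(2)) (simp add: unglue_def lin_ext_def[of _ x])
    also have "\<dots> \<in> S"
      using x(1) S unglue_generators[where 'k = 'k]
      by (intro subspace_sum subspace_scale) (auto simp: free_space_def)
    finally show "z \<in> S" .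
  qed
  ultimately show ?thesis
    unfolding glued_algebra_def by blast
qed

end

end

theory Submission
  imports Defs
begin

text \<open>
  In characteristic \<open>0\<close> the cocycles of a radical square zero algebra are spanned by the pairs of
  parallel arrows, i.e. they form a product of matrix algebras, one for each class of parallel
  arrows, with bracket \<open>[x, y] = yx - xy\<close>; the coboundaries are the gradients of functions on the
  vertices, which are central diagonal matrices. Special pairs of arrows would span cocycles, so there
  are none; hence one glued arrow \<open>\<mu>\<close> is alone in its class, and cocycles of \<open>B\<close> lift to cocycles of
  \<open>A\<close> once the entry at \<open>\<mu> \<parallel> \<mu>\<close> is set to the normalized trace of the class of \<open>\<gamma>\<^sup>*\<close>, so that gradients lift
  to gradients. The central factor \<open>k\<close> is detected by the signed sum of the normalized traces along a walk
  from \<open>e\<^sub>1\<close> to \<open>e\<^bsub>n-1\<^esub>\<close>: it takes the gradient of \<open>f\<close> to \<open>f(e\<^sub>1) - f(e\<^bsub>n-1\<^esub>)\<close>.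
\<close>

section \<open>Cocycles of a radical square zero algebra\<close>

text \<open>Membership in \<open>arcs Q\<close> is included so that this is an equivalence relation
  on the arrows and empty elsewhere; its classes index the matrix blocks.\<close>

definition arc_parallel :: "('v, 'a) pre_digraph \<Rightarrow> 'a \<Rightarrow> 'a \<Rightarrow> bool" where
  "arc_parallel Q a b \<longleftrightarrow>
    a \<in> arcs Q \<and> b \<in> arcs Q \<and> tail Q a = tail Q b \<and> head Q a = head Q b"

definition arrow_pairs :: "('v, 'a) pre_digraph \<Rightarrow> (('v, 'a) path \<times> ('v, 'a) path) set" where
  "arrow_pairs Q = {(arrow_path Q a, arrow_path Q b) | a b. arc_parallel Q a b}"

definition entry :: "('v, 'a) pre_digraph \<Rightarrow> ('v, 'a, 'k::field) cochain \<Rightarrow> 'a \<Rightarrow> 'a \<Rightarrow> 'k" where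
  "entry Q x a b = Poly_Mapping.lookup x (arrow_path Q a, arrow_path Q b)"

text \<open>The coboundary of the vertex function \<open>f\<close>. The sign, source minus target,
  is that of \<open>delta0\<close>.\<close>

definition gradient :: "('v, 'a) pre_digraph \<Rightarrow> ('v \<Rightarrow> 'k) \<Rightarrow> ('v, 'a, 'k::field) cochain" where
  "gradient Q f = (\<Sum>a\<in>arcs Q.
     Poly_Mapping.single (arrow_path Q a, arrow_path Q a) (f (tail Q a) - f (head Q a)))"

section \<open>Scalars and coefficients of cochains\<close>

lemma pm_scale_single [simp]: "pm_scale c (Poly_Mapping.single k d) = Poly_Mapping.single k (c * d)"
  by (rule poly_mapping_eqI) (simp add: lookup_single when_def)

lemma pm_scale_0 [simp]: "pm_scale 0 x = 0" "pm_scale c 0 = 0"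
  by (auto intro!: poly_mapping_eqI)

lemma pm_scale_diff: "pm_scale c (x - y) = pm_scale c x - pm_scale c y"
  by (rule poly_mapping_eqI) (simp add: lookup_minus algebra_simps)

lemma pm_scale_uminus: "pm_scale (- 1) x = - x"
  by (rule poly_mapping_eqI) simp

lemma entry_simps [simp]:
  "entry Q (x + y) a b = entry Q x a b + entry Q y a b"
  "entry Q (x - y) a b = entry Q x a b - entry Q y a b"
  "entry Q (- x) a b = - entry Q x a b"
  "entry Q 0 a b = 0"
  "entry Q (pm_scale c x) a b = c * entry Q x a b"
  by (simp_all add: entry_def lookup_add lookup_minus)

lemma lookup_path_pair:
  "Poly_Mapping.lookup (path_pair r y) (s, p) = (if s = r then Poly_Mapping.lookup y p else 0)"
proof -
  have "Poly_Mapping.lookup (path_pair r y) (s, p)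
      = (\<Sum>q\<in>Poly_Mapping.keys y. if q = p then (if s = r then Poly_Mapping.lookup y p else 0) else 0)"
    unfolding path_pair_def lin_ext_def lookup_sum
    by (intro sum.cong refl) (auto simp: lookup_single when_def)
  then show ?thesis by (simp add: in_keys_iff)
qed

lemma path_pair_simps [simp]:
  "path_pair r 0 = 0" "path_pair r (Poly_Mapping.single p 1) = Poly_Mapping.single (r, p) 1"
  by (simp_all add: path_pair_def)

section \<open>Kernel of \<open>delta1\<close> and image of \<open>delta0\<close>\<close>

locale rad_square_zero_quiver = fin_digraph Q
  for Q :: "('v, 'a) pre_digraph" and Z :: "('v, 'a) path set" +
  assumes rsz: "radical_square_zero Q Z"
begin

lemma basis: "path_basis Q Z = trivial_path ` verts Q \<union> arrow_path Q ` arcs Q"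
  by (rule path_basis_rad_square_zero) (unfold_locales, rule rsz)

lemma long_not_basis: "length (snd p) \<ge> 2 \<Longrightarrow> p \<notin> path_basis Q Z"
  by (auto simp: basis trivial_path_def arrow_path_def)

lemma Z_length: "r \<in> Z \<Longrightarrow> length (snd r) = 2"
  using rsz by (simp add: radical_square_zero_def length_two_paths_def path_length_def)

text \<open>Needed because \<open>delta1\<close> is a sum over \<open>Z\<close>, which would be 0 by
  convention over an infinite set.\<close>

lemma finite_Z: "finite Z"
proof (rule finite_subset)
  show "Z \<subseteq> verts Q \<times> {as. set as \<subseteq> arcs Q \<and> length as = 2}"
    using rsz by (auto simp: radical_square_zero_def length_two_paths_def path_length_def
        paths_def awalk_def)
  show "finite (verts Q \<times> {as. set as \<subseteq> arcs Q \<and> length as = 2})"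
    by (simp add: finite_lists_length_eq)
qed

lemma loop_square_Z:
  assumes "a \<in> arcs Q" "head Q a = tail Q a"
  shows "(tail Q a, [a, a]) \<in> Z"
  using assms rsz
  by (auto simp: radical_square_zero_def length_two_paths_def path_length_def paths_def awalk_def
      intro: wellformed)

text \<open>Exchanging an arrow for an arrow keeps the length of a relation at two, and no basis
  path is that long.\<close>

lemma delta1_arrow:
  assumes "arc_parallel Q a b"
  shows "delta1 Q Z (Poly_Mapping.single (arrow_path Q a, arrow_path Q b) 1)
    = (0 :: ('v, 'a, 'k::field) cochain)"
proof -
  have "replace_sum Q Z r (arrow_path Q a, arrow_path Q b) = (0 :: _ \<Rightarrow>\<^sub>0 'k)" if "r \<in> Z" for r
  proof -
    have "replace_at r i (arrow_path Q b) \<notin> path_basis Q Z" if "i < length (snd r)" for i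
      using that Z_length[OF \<open>r \<in> Z\<close>]
      by (intro long_not_basis) (auto simp: replace_at_def arrow_path_def)
    then have "{i. i < length (snd r) \<and> [snd r ! i] = snd (arrow_path Q a) \<and>
        replace_at r i (arrow_path Q b) \<in> path_basis Q Z} = {}"
      by blast
    then show ?thesis by (simp only: replace_sum_def prod.case sum.empty)
  qed
  then show ?thesis by (simp add: delta1_def)
qed

text \<open>Detects the component \<open>a \<parallel> e\<close> of a cocycle at a loop \<open>a\<close>: replacing either arrow of \<open>a\<^sup>2\<close> gives \<open>2a\<close>.\<close>

lemma lookup_delta1_loop:
  assumes x: "x \<in> cochains1 Q Z" and a: "a \<in> arcs Q" "head Q a = tail Q a"
  shows "Poly_Mapping.lookup (delta1 Q Z x :: ('v, 'a, 'k::field) cochain)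
      ((tail Q a, [a, a]), arrow_path Q a)
    = 2 * Poly_Mapping.lookup x (arrow_path Q a, trivial_path (tail Q a))"
proof -
  let ?r = "(tail Q a, [a, a])" and ?k = "(arrow_path Q a, trivial_path (tail Q a))"
  have rep: "Poly_Mapping.lookup (replace_sum Q Z ?r k :: _ \<Rightarrow>\<^sub>0 'k) (arrow_path Q a) = (if k = ?k then 2 else 0)"
    if k: "k \<in> Poly_Mapping.keys x" for k
  proof -
    obtain b \<gamma> where b: "k = (arrow_path Q b, \<gamma>)" "\<gamma> \<in> path_basis Q Z" "parallel Q (arrow_path Q b) \<gamma>"
      using x k by (auto simp: cochains1_def free_space_def parallel_pairs_def)
    let ?I = "{i. i < length (snd ?r) \<and> [snd ?r ! i] = snd (arrow_path Q b) \<and> replace_at ?r i \<gamma> \<in> path_basis Q Z}"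
    have sum: "Poly_Mapping.lookup (replace_sum Q Z ?r k :: _ \<Rightarrow>\<^sub>0 'k) (arrow_path Q a)
        = (\<Sum>i\<in>?I. 1 when replace_at ?r i \<gamma> = arrow_path Q a)"
      by (simp add: replace_sum_def b lookup_sum lookup_single)
    show ?thesis
    proof (cases "k = ?k")
      case True
      then have \<gamma>: "b = a" "\<gamma> = trivial_path (tail Q a)" using b(1) by auto
      have rep: "replace_at ?r i \<gamma> = arrow_path Q a" if "i < 2" for i
        using that by (auto simp: replace_at_def \<gamma> trivial_path_def arrow_path_def less_2_cases_iff)
      \<comment> \<open>Erasing either factor of the squared loop leaves \<open>a\<close>; the two
        positions account for the coefficient 2.\<close>
      have "?I = {0, 1}"
        using rep a by (auto simp: basis \<gamma>(1)) (auto simp: arrow_path_def less_Suc_eq)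
      then show ?thesis unfolding sum using True rep by simp
    next
      case False
      \<comment> \<open>An arrow \<open>b\<close> other than \<open>a\<close> does not occur in the
        squared loop. For \<open>b = a\<close>, the only trivial path parallel to \<open>a\<close>
        is the one in \<open>?k\<close>, so \<gamma> is an arrow and the replacement still has
        length two.\<close>
      have "?I = {}"
      proof (cases "b = a")
        case True
        then obtain c where "\<gamma> = arrow_path Q c"
          using False b by (auto simp: basis parallel_def)
        then have "replace_at ?r i \<gamma> \<notin> path_basis Q Z" if "i < 2" for i
          using that by (intro long_not_basis) (auto simp: replace_at_def arrow_path_def)
        then show ?thesis by auto
      qed (auto simp: arrow_path_def nth_Cons split: nat.splits)
      then show ?thesis using False by (simp only: sum) simp
    qed
  qed
  have Z: "?r \<in> Z" by (rule loop_square_Z) fact+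
  have "Poly_Mapping.lookup (delta1 Q Z x) (?r, arrow_path Q a)
      = (\<Sum>k\<in>Poly_Mapping.keys x. Poly_Mapping.lookup x k *
          Poly_Mapping.lookup (replace_sum Q Z ?r k :: _ \<Rightarrow>\<^sub>0 'k) (arrow_path Q a))"
    unfolding delta1_def lin_ext_def lookup_sum
    using Z finite_Z by (intro sum.cong refl) (simp add: lookup_sum lookup_path_pair split: prod.splits)
  also have "\<dots> = (\<Sum>k\<in>Poly_Mapping.keys x. if k = ?k then 2 * Poly_Mapping.lookup x ?k else 0)"
    using rep by (intro sum.cong refl) auto
  also have "\<dots> = 2 * Poly_Mapping.lookup x ?k"
    by (simp add: in_keys_iff)
  finally show ?thesis .
qed

text \<open>An arrow is parallel to other arrows and, if it is a loop, to its vertex. Pairs of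
  arrows are cocycles; a loop-vertex component is doubled by \<open>delta1\<close>, hence must
  vanish as 2 is invertible.\<close>

lemma ker_delta1_eq:
  assumes "CHAR('k) = 0"
  shows "ker_delta1 Q Z = (free_space (arrow_pairs Q) :: ('v, 'a, 'k::field) cochain set)"
proof (intro equalityI subsetI)
  fix x :: "('v, 'a, 'k) cochain"
  assume "x \<in> ker_delta1 Q Z"
  then have x: "x \<in> cochains1 Q Z" "delta1 Q Z x = 0" by (auto simp: ker_delta1_def)
  have two: "(2::'k) \<noteq> 0"
    using assms of_nat_eq_0_iff_char_dvd[of 2, where 'a = 'k] by simp
  show "x \<in> free_space (arrow_pairs Q)"
    unfolding free_space_def
  proof (rule CollectI, rule subsetI)
    fix k assume k: "k \<in> Poly_Mapping.keys x"
    then obtain a \<gamma> where a: "k = (arrow_path Q a, \<gamma>)" "a \<in> arcs Q" "\<gamma> \<in> path_basis Q Z"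
      "parallel Q (arrow_path Q a) \<gamma>"
      using x by (auto simp: cochains1_def free_space_def parallel_pairs_def)
    have "\<gamma> \<notin> trivial_path ` verts Q"
      using lookup_delta1_loop[OF x(1) a(2)] x(2) two k a by (auto simp: parallel_def in_keys_iff)
    then show "k \<in> arrow_pairs Q"
      using a by (auto simp: basis parallel_def arrow_pairs_def arc_parallel_def)
  qed
next
  fix x :: "('v, 'a, 'k) cochain"
  assume x: "x \<in> free_space (arrow_pairs Q)"
  then have "x \<in> cochains1 Q Z"
    by (fastforce simp: cochains1_def free_space_def arrow_pairs_def parallel_pairs_def basis
        parallel_def arc_parallel_def)
  moreover have "delta1 Q Z x = (\<Sum>k\<in>Poly_Mapping.keys x. pm_scale (Poly_Mapping.lookup x k)
      (delta1 Q Z (Poly_Mapping.single k 1)))"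
    by (simp add: delta1_def lin_ext_def[of _ x])
  moreover have "delta1 Q Z (Poly_Mapping.single k 1) = (0 :: ('v, 'a, 'k) cochain)"
    if "k \<in> Poly_Mapping.keys x" for k
    using that x delta1_arrow by (auto simp: free_space_def arrow_pairs_def)
  ultimately show "x \<in> ker_delta1 Q Z" by (simp add: ker_delta1_def)
qed

text \<open>A vertex paired with a loop contributes nothing, since composing the loop with an arrow
  gives a path of length two. What remains are the pairs of a vertex with itself, and their sum is
  regrouped by the sources and by the targets of the arrows.\<close>

lemma delta0_eq:
  assumes x: "x \<in> cochains0 Q Z"
  shows "delta0 Q Z x = (gradient Q (\<lambda>v. Poly_Mapping.lookup x (trivial_path v, trivial_path v))
    :: ('v, 'a, 'k::field) cochain)"
proof -
  let ?f = "\<lambda>v. Poly_Mapping.lookup x (trivial_path v, trivial_path v)"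
  let ?E = "\<lambda>a. Poly_Mapping.single (arrow_path Q a, arrow_path Q a) (1::'k)"
  let ?T = "(\<lambda>v. (trivial_path v, trivial_path v)) ` verts Q"
  have triv: "delta0 Q Z (Poly_Mapping.single (trivial_path v, trivial_path v) 1)
      = (\<Sum>a | a \<in> arcs Q \<and> tail Q a = v. ?E a) - (\<Sum>a | a \<in> arcs Q \<and> head Q a = v. ?E a)" for v
    unfolding delta0_def lin_ext_single prod.case
    by (intro arg_cong2[where f = "(-)"] sum.cong) (auto simp: basis)
  have loop: "delta0 Q Z (Poly_Mapping.single (e, \<gamma>) 1) = (0 :: ('v, 'a, 'k) cochain)"
    if k: "(e, \<gamma>) \<in> Poly_Mapping.keys x - ?T" for e \<gamma>
  proof -
    have "(e, \<gamma>) \<in> parallel_pairs Q (trivial_path ` verts Q) (path_basis Q Z)"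
      using k x by (auto simp: cochains0_def free_space_def)
    then obtain c where \<gamma>: "\<gamma> = arrow_path Q c"
      using k by (auto simp: parallel_pairs_def basis parallel_def)
    have "path_comp (arrow_path Q a) \<gamma> \<notin> path_basis Q Z" "path_comp \<gamma> (arrow_path Q a) \<notin> path_basis Q Z" for a
      by (intro long_not_basis; simp add: \<gamma> path_comp_def arrow_path_def)+
    then show ?thesis by (simp add: delta0_def)
  qed
  \<comment> \<open>The sum is extended to all vertices, those outside the support having
    coefficient 0.\<close>
  have "delta0 Q Z x = (\<Sum>k\<in>Poly_Mapping.keys x \<union> ?T.
      pm_scale (Poly_Mapping.lookup x k) (delta0 Q Z (Poly_Mapping.single k 1)))"
    using lin_ext_cong_sum[of "Poly_Mapping.keys x \<union> ?T" x] by (simp add: delta0_def)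
  also have "\<dots> = (\<Sum>k\<in>?T. pm_scale (Poly_Mapping.lookup x k) (delta0 Q Z (Poly_Mapping.single k 1)))"
    using loop by (intro sum.mono_neutral_right) auto
  also have "\<dots> = (\<Sum>v\<in>verts Q. pm_scale (?f v)
      (delta0 Q Z (Poly_Mapping.single (trivial_path v, trivial_path v) 1)))"
    by (subst sum.reindex) (auto intro!: inj_onI)
  also have "\<dots> = (\<Sum>v\<in>verts Q. \<Sum>a | a \<in> arcs Q \<and> tail Q a = v. pm_scale (?f (tail Q a)) (?E a))
      - (\<Sum>v\<in>verts Q. \<Sum>a | a \<in> arcs Q \<and> head Q a = v. pm_scale (?f (head Q a)) (?E a))"
    unfolding triv pm_scale_diff pm_scale_sum sum_subtractf
    by (intro arg_cong2[where f = "(-)"] sum.cong refl) auto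
  also have "\<dots> = (\<Sum>a\<in>arcs Q. pm_scale (?f (tail Q a)) (?E a)) - (\<Sum>a\<in>arcs Q. pm_scale (?f (head Q a)) (?E a))"
    by (intro arg_cong2[where f = "(-)"] sum.group) auto
  also have "\<dots> = gradient Q ?f"
    by (simp add: gradient_def sum_subtractf single_diff)
  finally show ?thesis .
qed

lemma im_delta0_eq: "im_delta0 Q Z = range (gradient Q :: ('v \<Rightarrow> 'k) \<Rightarrow> ('v, 'a, 'k::field) cochain)"
proof (intro equalityI subsetI)
  fix y :: "('v, 'a, 'k) cochain" assume "y \<in> range (gradient Q)"
  then obtain f where y: "y = gradient Q f" by blast
  \<comment> \<open>This cochain agrees with \<open>f\<close> on \<open>verts Q\<close>, and a
    gradient evaluates \<open>f\<close> only at end points of arrows.\<close>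
  let ?x = "\<Sum>v\<in>verts Q. Poly_Mapping.single (trivial_path v, trivial_path v :: ('v, 'a) path) (f v)"
  have lk: "Poly_Mapping.lookup ?x (trivial_path u, trivial_path u) = f u" if "u \<in> verts Q" for u
    using that by (simp add: lookup_sum lookup_single when_def)
  have "Poly_Mapping.keys ?x \<subseteq> (\<Union>v\<in>verts Q. Poly_Mapping.keys (Poly_Mapping.single (trivial_path v, trivial_path v) (f v)))"
    by (rule Poly_Mapping.keys_sum)
  also have "\<dots> \<subseteq> parallel_pairs Q (trivial_path ` verts Q) (path_basis Q Z)"
    by (auto simp: parallel_pairs_def basis parallel_def split: if_splits)
  finally have x: "?x \<in> cochains0 Q Z"
    by (simp add: cochains0_def free_space_def)
  have "delta0 Q Z ?x = y"
    unfolding delta0_eq[OF x] y gradient_def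
    by (intro sum.cong refl) (simp add: lk)
  with x show "y \<in> im_delta0 Q Z" unfolding im_delta0_def by blast
qed (auto simp: im_delta0_def delta0_eq)

section \<open>Arrow cochains as matrices indexed by arrows\<close>

lemma entry_gradient:
  "entry Q (gradient Q f) a b = (if a = b \<and> a \<in> arcs Q then f (tail Q a) - f (head Q a) else 0)"
proof -
  have "entry Q (gradient Q f) a b
      = (\<Sum>c\<in>arcs Q. if c = a then (if a = b then f (tail Q a) - f (head Q a) else 0) else 0)"
    unfolding entry_def gradient_def lookup_sum
    by (intro sum.cong refl) (auto simp: lookup_single when_def)
  then show ?thesis by simp
qed

lemma gradient_arrow_cochain: "gradient Q f \<in> free_space (arrow_pairs Q)"
proof -
  have "Poly_Mapping.keys (gradient Q f) \<subseteq> (\<Union>a\<in>arcs Q. Poly_Mapping.keys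
      (Poly_Mapping.single (arrow_path Q a, arrow_path Q a) (f (tail Q a) - f (head Q a))))"
    unfolding gradient_def by (rule Poly_Mapping.keys_sum)
  also have "\<dots> \<subseteq> arrow_pairs Q"
    by (auto simp: arrow_pairs_def arc_parallel_def split: if_splits)
  finally show ?thesis by (simp add: free_space_def)
qed

lemma entry_nonparallel: "x \<in> free_space (arrow_pairs Q) \<Longrightarrow> \<not> arc_parallel Q a b \<Longrightarrow> entry Q x a b = 0"
  by (auto simp: free_space_def arrow_pairs_def entry_def in_keys_iff)

lemma arrow_cochain_eqI:
  assumes "x \<in> free_space (arrow_pairs Q)" "y \<in> free_space (arrow_pairs Q)"
    and "\<And>a b. arc_parallel Q a b \<Longrightarrow> entry Q x a b = entry Q y a b"
  shows "x = y"
proof (rule poly_mapping_eqI)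
  fix k
  show "Poly_Mapping.lookup x k = Poly_Mapping.lookup y k"
  proof (cases "k \<in> arrow_pairs Q")
    case True
    then show ?thesis using assms(3) by (auto simp: arrow_pairs_def entry_def)
  next
    case False
    then have "k \<notin> Poly_Mapping.keys x" "k \<notin> Poly_Mapping.keys y"
      using assms by (auto simp: free_space_def)
    then show ?thesis by (simp add: in_keys_iff)
  qed
qed

text \<open>Inverse to \<open>entry\<close> on matrices supported on parallel pairs; all other
  entries of \<open>X\<close> are discarded.\<close>

definition cochain_of :: "('a \<Rightarrow> 'a \<Rightarrow> 'k) \<Rightarrow> ('v, 'a, 'k::field) cochain" where
  "cochain_of X = (\<Sum>(a, b) | arc_parallel Q a b.
     Poly_Mapping.single (arrow_path Q a, arrow_path Q b) (X a b))"

lemma finite_arc_parallel: "finite {(a, b). arc_parallel Q a b}"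
  by (rule finite_subset[of _ "arcs Q \<times> arcs Q"]) (auto simp: arc_parallel_def)

lemma entry_cochain_of: "entry Q (cochain_of X) a b = (if arc_parallel Q a b then X a b else 0)"
proof -
  have "entry Q (cochain_of X) a b
      = (\<Sum>p\<in>{(a, b). arc_parallel Q a b}. if p = (a, b) then X a b else 0)"
    unfolding entry_def cochain_of_def lookup_sum
    by (intro sum.cong refl) (auto simp: lookup_single when_def split: if_splits)
  then show ?thesis using finite_arc_parallel by simp
qed

lemma cochain_of_arrow_cochain: "cochain_of X \<in> free_space (arrow_pairs Q)"
proof -
  have "Poly_Mapping.keys (cochain_of X) \<subseteq> (\<Union>p\<in>{(a, b). arc_parallel Q a b}. Poly_Mapping.keys
      ((\<lambda>(a, b). Poly_Mapping.single (arrow_path Q a, arrow_path Q b) (X a b)) p))"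
    unfolding cochain_of_def by (rule Poly_Mapping.keys_sum)
  also have "\<dots> \<subseteq> arrow_pairs Q"
    by (auto simp: arrow_pairs_def split: if_splits)
  finally show ?thesis by (simp add: free_space_def)
qed

text \<open>Summing over all pairs of arrows is harmless, since non-parallel ones have coefficient
  0, and it leaves independent indices whose sums can be exchanged.\<close>

lemma lin_ext_arrow_cochain:
  assumes "x \<in> free_space (arrow_pairs Q)"
  shows "lin_ext g x = (\<Sum>a\<in>arcs Q. \<Sum>b\<in>arcs Q. pm_scale (entry Q x a b) (g (arrow_path Q a, arrow_path Q b)))"
proof -
  let ?p = "\<lambda>(a, b). (arrow_path Q a, arrow_path Q b)"
  have "Poly_Mapping.keys x \<subseteq> ?p ` (arcs Q \<times> arcs Q)"
    using assms by (auto simp: free_space_def arrow_pairs_def arc_parallel_def dest!: subsetD)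
  then have "lin_ext g x = (\<Sum>k\<in>?p ` (arcs Q \<times> arcs Q). pm_scale (Poly_Mapping.lookup x k) (g k))"
    by (intro lin_ext_cong_sum) auto
  also have "\<dots> = (\<Sum>(a, b)\<in>arcs Q \<times> arcs Q. pm_scale (entry Q x a b) (g (arrow_path Q a, arrow_path Q b)))"
    by (subst sum.reindex) (auto intro!: inj_onI sum.cong simp: entry_def)
  finally show ?thesis by (simp add: sum.cartesian_product)
qed

section \<open>The bracket in terms of matrix entries\<close>

lemma replace_sum_arrow:
  assumes "arc_parallel Q a c" "e \<in> arcs Q"
  shows "replace_sum Q Z (arrow_path Q e) (arrow_path Q a, arrow_path Q c)
    = (if e = a then Poly_Mapping.single (arrow_path Q c) 1 else (0 :: _ \<Rightarrow>\<^sub>0 'k::field))"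
proof -
  \<comment> \<open>\<open>replace_at\<close> keeps the start vertex of \<open>a\<close>, so this
    relies on \<open>a\<close> and \<open>c\<close> having the same source.\<close>
  have "replace_at (arrow_path Q a) 0 (arrow_path Q c) = arrow_path Q c"
    using assms by (simp add: replace_at_def arrow_path_def arc_parallel_def)
  moreover have "arrow_path Q c \<in> path_basis Q Z"
    using assms by (simp add: basis arc_parallel_def)
  ultimately have "{i. i < length (snd (arrow_path Q e)) \<and> [snd (arrow_path Q e) ! i] = snd (arrow_path Q a) \<and>
      replace_at (arrow_path Q e) i (arrow_path Q c) \<in> path_basis Q Z} = (if e = a then {0} else {})"
    by (auto simp: arrow_path_def)
  then show ?thesis
    using \<open>replace_at _ _ _ = _\<close> unfolding replace_sum_def by simp
qed

text \<open>An arrow has a single position to replace, so each bracket of basis pairs has at most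
  two terms. The formula may be used for all quadruples because non-parallel ones have coefficient
  0.\<close>

lemma bracket_eq:
  assumes x: "x \<in> free_space (arrow_pairs Q)" and y: "y \<in> free_space (arrow_pairs Q)"
  shows "cochain_bracket Q Z x y = (\<Sum>a\<in>arcs Q. \<Sum>c\<in>arcs Q. \<Sum>b\<in>arcs Q. \<Sum>e\<in>arcs Q.
    pm_scale (entry Q x a c * entry Q y b e)
      ((if e = a then Poly_Mapping.single (arrow_path Q b, arrow_path Q c) 1 else 0)
       - (if c = b then Poly_Mapping.single (arrow_path Q a, arrow_path Q e) (1 :: 'k::field) else 0)))"
proof -
  have "pm_scale (entry Q x a c) (pm_scale (entry Q y b e)
        (path_pair (arrow_path Q b) (replace_sum Q Z (arrow_path Q e) (arrow_path Q a, arrow_path Q c))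
       - path_pair (arrow_path Q a) (replace_sum Q Z (arrow_path Q c) (arrow_path Q b, arrow_path Q e))))
    = pm_scale (entry Q x a c * entry Q y b e)
      ((if e = a then Poly_Mapping.single (arrow_path Q b, arrow_path Q c) 1 else 0)
       - (if c = b then Poly_Mapping.single (arrow_path Q a, arrow_path Q e) (1 :: 'k) else 0))"
    for a b c e
  proof (cases "arc_parallel Q a c \<and> arc_parallel Q b e")
    case True
    then have "replace_sum Q Z (arrow_path Q e) (arrow_path Q a, arrow_path Q c)
        = (if e = a then Poly_Mapping.single (arrow_path Q c) 1 else (0 :: _ \<Rightarrow>\<^sub>0 'k))"
      "replace_sum Q Z (arrow_path Q c) (arrow_path Q b, arrow_path Q e)
        = (if c = b then Poly_Mapping.single (arrow_path Q e) 1 else (0 :: _ \<Rightarrow>\<^sub>0 'k))"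
      by (simp_all add: replace_sum_arrow) (simp_all add: replace_sum_arrow arc_parallel_def)
    then show ?thesis by (auto intro!: poly_mapping_eqI)
  next
    case False
    then have "entry Q x a c = 0 \<or> entry Q y b e = 0"
      using entry_nonparallel[OF x] entry_nonparallel[OF y] by blast
    then show ?thesis by auto
  qed
  then show ?thesis
    unfolding cochain_bracket_def
    by (simp add: lin_ext_arrow_cochain[OF x] lin_ext_arrow_cochain[OF y] pm_scale_sum)
qed

lemma entry_bracket:
  assumes x: "x \<in> free_space (arrow_pairs Q)" and y: "y \<in> free_space (arrow_pairs Q)"
    and pq: "p \<in> arcs Q" "q \<in> arcs Q"
  shows "entry Q (cochain_bracket Q Z x y :: ('v, 'a, 'k::field) cochain) p q
    = (\<Sum>c\<in>arcs Q. entry Q y p c * entry Q x c q) - (\<Sum>c\<in>arcs Q. entry Q x p c * entry Q y c q)"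
proof -
  have "entry Q (cochain_bracket Q Z x y) p q
    = Poly_Mapping.lookup (cochain_bracket Q Z x y) (arrow_path Q p, arrow_path Q q)"
    by (rule entry_def)
  \<comment> \<open>The conditions are nested in the order of the sums, from the innermost outwards,
    so that each removes one sum; only \<open>a\<close> survives in the first term and only
    \<open>c\<close> in the second.\<close>
  also have "\<dots> = (\<Sum>a\<in>arcs Q. \<Sum>c\<in>arcs Q. \<Sum>b\<in>arcs Q. \<Sum>e\<in>arcs Q. 
        (if e = a then if b = p then if c = q then entry Q x a c * entry Q y b e else 0 else 0 else 0)
      - (if e = q then if b = c then if a = p then entry Q x a c * entry Q y b e else 0 else 0 else 0))"
    unfolding bracket_eq[OF x y] lookup_sum lookup_pm_scale
    by (intro sum.cong refl) (auto simp: lookup_minus lookup_single when_def)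
  also have "\<dots> = (\<Sum>a\<in>arcs Q. entry Q x a q * entry Q y p a) - (\<Sum>c\<in>arcs Q. entry Q x p c * entry Q y c q)"
    using pq by (simp add: sum_subtractf if_distrib[of "sum _"] cong: if_cong)
      (simp add: sum.swap[of _ "arcs Q" "arcs Q"])
  finally show ?thesis by (simp add: mult.commute)
qed

text \<open>By transitivity of parallelism, both terms of a bracket of parallel pairs are again
  parallel pairs.\<close>

lemma bracket_arrow_cochain:
  assumes x: "x \<in> free_space (arrow_pairs Q)" and y: "y \<in> free_space (arrow_pairs Q)"
  shows "cochain_bracket Q Z x y \<in> (free_space (arrow_pairs Q) :: ('v, 'a, 'k::field) cochain set)"
  unfolding free_space_def
proof (rule CollectI, rule subsetI, rule ccontr)
  fix k assume k: "k \<in> Poly_Mapping.keys (cochain_bracket Q Z x y)" "k \<notin> arrow_pairs Q"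
  have "(entry Q x a c * entry Q y b e) * Poly_Mapping.lookup
      ((if e = a then Poly_Mapping.single (arrow_path Q b, arrow_path Q c) 1 else 0)
       - (if c = b then Poly_Mapping.single (arrow_path Q a, arrow_path Q e) (1::'k) else 0)) k = 0" for a b c e
  proof (cases "arc_parallel Q a c \<and> arc_parallel Q b e")
    case True
    then have "e = a \<Longrightarrow> arc_parallel Q b c" "c = b \<Longrightarrow> arc_parallel Q a e"
      by (auto simp: arc_parallel_def)
    then show ?thesis using k(2) by (auto simp: arrow_pairs_def lookup_minus lookup_single when_def)
  qed (auto simp: entry_nonparallel x y)
  then have "Poly_Mapping.lookup (cochain_bracket Q Z x y) k = 0"
    unfolding bracket_eq[OF x y] lookup_sum lookup_pm_scale by (simp only: sum.neutral_const)
  with k(1) show False by (simp add: in_keys_iff)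
qed

end


lemma free_space_closed:
  fixes x y :: "'b \<Rightarrow>\<^sub>0 'k::field"
  shows "0 \<in> free_space X"
    and "x \<in> free_space X \<Longrightarrow> y \<in> free_space X \<Longrightarrow> x + y \<in> free_space X"
    and "x \<in> free_space X \<Longrightarrow> pm_scale c x \<in> free_space X"
    and "x \<in> free_space X \<Longrightarrow> - x \<in> free_space X"
    and "x \<in> free_space X \<Longrightarrow> y \<in> free_space X \<Longrightarrow> x - y \<in> free_space X"
  by (auto simp: free_space_def in_keys_iff subset_iff lookup_add lookup_minus) (metis add_0 diff_0_right)+

lemma gradient_simps:
  "gradient Q (\<lambda>v. 0) = 0"
  "gradient Q f + gradient Q g = gradient Q (\<lambda>v. f v + g v)"
  "gradient Q f - gradient Q g = gradient Q (\<lambda>v. f v - g v)"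
  "pm_scale c (gradient Q f) = gradient Q (\<lambda>v. c * f v)"
  by (simp_all add: gradient_def sum.distrib[symmetric] sum_subtractf[symmetric] pm_scale_sum
      single_add[symmetric] single_diff[symmetric] algebra_simps)

text \<open>The normalized trace of the matrix block belonging to the class of
  \<open>c\<close>.\<close>

definition average :: "('v, 'a) pre_digraph \<Rightarrow> 'a \<Rightarrow> ('v, 'a, 'k::field) cochain \<Rightarrow> 'k" where
  "average Q c x = (\<Sum>a | arc_parallel Q a c. entry Q x a a) / of_nat (card {a. arc_parallel Q a c})"

lemma average_add: "average Q c (x + y) = average Q c x + average Q c y"
  by (simp add: average_def sum.distrib add_divide_distrib)

lemma average_scale: "average Q c (pm_scale d x) = d * average Q c x"
  by (simp add: average_def sum_distrib_left[symmetric])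

section \<open>Lie identities from matrix algebra\<close>

context rad_square_zero_quiver
begin

text \<open>The product runs over all arrows instead of one class, so that its algebraic laws hold
  for arbitrary functions, without support conditions.\<close>

definition mat_mult :: "('a \<Rightarrow> 'a \<Rightarrow> 'k::field) \<Rightarrow> ('a \<Rightarrow> 'a \<Rightarrow> 'k) \<Rightarrow> 'a \<Rightarrow> 'a \<Rightarrow> 'k" where
  "mat_mult X Y p q = (\<Sum>c\<in>arcs Q. X p c * Y c q)"

lemma mat_mult_assoc: "mat_mult (mat_mult X Y) W p q = mat_mult X (mat_mult Y W) p q"
  unfolding mat_mult_def sum_distrib_left sum_distrib_right
  by (subst sum.swap) (simp add: mult.assoc)

lemma mat_mult_diff:
  "mat_mult (\<lambda>p q. X p q - Y p q) W p q = mat_mult X W p q - mat_mult Y W p q"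
  "mat_mult W (\<lambda>p q. X p q - Y p q) p q = mat_mult W X p q - mat_mult W Y p q"
  by (simp_all add: mat_mult_def algebra_simps sum_subtractf)

lemma mat_mult_add:
  "mat_mult (\<lambda>p q. X p q + Y p q) W p q = mat_mult X W p q + mat_mult Y W p q"
  "mat_mult W (\<lambda>p q. X p q + Y p q) p q = mat_mult W X p q + mat_mult W Y p q"
  by (simp_all add: mat_mult_def algebra_simps sum.distrib)

lemma mat_mult_scale:
  "mat_mult (\<lambda>p q. d * X p q) W p q = d * mat_mult X W p q"
  "mat_mult W (\<lambda>p q. d * X p q) p q = d * mat_mult W X p q"
  by (simp_all add: mat_mult_def sum_distrib_left algebra_simps)

text \<open>Stated as an equality of functions so that iterated brackets unfold to matrix products;
  for this, indices outside \<open>arcs Q\<close>, where both sides vanish, are covered as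
  well.\<close>

lemma entry_bracket_mat:
  assumes x: "x \<in> free_space (arrow_pairs Q)" and y: "y \<in> free_space (arrow_pairs Q)"
  shows "entry Q (cochain_bracket Q Z x y)
    = (\<lambda>p q. mat_mult (entry Q y) (entry Q x) p q - mat_mult (entry Q x) (entry Q y) p q)"
proof (intro ext)
  fix p q
  show "entry Q (cochain_bracket Q Z x y) p q
    = mat_mult (entry Q y) (entry Q x) p q - mat_mult (entry Q x) (entry Q y) p q"
  proof (cases "p \<in> arcs Q \<and> q \<in> arcs Q")
    case True
    then show ?thesis using entry_bracket[OF x y] by (simp add: mat_mult_def)
  next
    case False
    then have "mat_mult (entry Q y) (entry Q x) p q = 0" "mat_mult (entry Q x) (entry Q y) p q = 0"
      unfolding mat_mult_def
      by (auto intro!: sum.neutral simp: entry_nonparallel[OF x] entry_nonparallel[OF y] arc_parallel_def)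
    moreover have "entry Q (cochain_bracket Q Z x y) p q = 0"
      using False by (intro entry_nonparallel bracket_arrow_cochain x y) (auto simp: arc_parallel_def)
    ultimately show ?thesis by simp
  qed
qed

lemma entry_fun_simps:
  "entry Q (x + y) = (\<lambda>p q. entry Q x p q + entry Q y p q)"
  "entry Q (pm_scale c x) = (\<lambda>p q. c * entry Q x p q)"
  by (simp_all add: fun_eq_iff)

lemmas bracket_simps =
  entry_bracket_mat bracket_arrow_cochain free_space_closed entry_fun_simps
  mat_mult_add mat_mult_scale mat_mult_diff

lemma bracket_bilinear:
  assumes "x \<in> free_space (arrow_pairs Q)" "y \<in> free_space (arrow_pairs Q)" "z \<in> free_space (arrow_pairs Q)"
  shows "cochain_bracket Q Z (x + y) z = cochain_bracket Q Z x z + cochain_bracket Q Z y z"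
    and "cochain_bracket Q Z z (x + y) = cochain_bracket Q Z z x + cochain_bracket Q Z z y"
    and "cochain_bracket Q Z (pm_scale c x) y = pm_scale c (cochain_bracket Q Z x y)"
    and "cochain_bracket Q Z x (pm_scale c y) = pm_scale c (cochain_bracket Q Z x y)"
  using assms by (auto intro!: arrow_cochain_eqI simp: bracket_simps algebra_simps)

lemma bracket_self:
  assumes "x \<in> free_space (arrow_pairs Q)"
  shows "cochain_bracket Q Z x x = 0"
  using assms by (auto intro!: arrow_cochain_eqI simp: bracket_simps)

text \<open>The bracket is a commutator of matrices, so everything cancels by associativity of
  \<open>mat_mult\<close>.\<close>

lemma bracket_jacobi:
  assumes "x \<in> free_space (arrow_pairs Q)" "y \<in> free_space (arrow_pairs Q)" "z \<in> free_space (arrow_pairs Q)"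
  shows "cochain_bracket Q Z x (cochain_bracket Q Z y z) + (cochain_bracket Q Z y (cochain_bracket Q Z z x)
    + cochain_bracket Q Z z (cochain_bracket Q Z x y)) = 0"
  using assms by (auto intro!: arrow_cochain_eqI simp: bracket_simps mat_mult_assoc)

text \<open>A gradient is diagonal, with values depending only on the ends of an arrow; it is thus
  scalar on every block, hence central.\<close>

lemma bracket_gradient:
  assumes x: "x \<in> free_space (arrow_pairs Q)"
  shows "cochain_bracket Q Z x (gradient Q f) = 0" "cochain_bracket Q Z (gradient Q f) x = 0"
proof -
  have "mat_mult (entry Q (gradient Q f)) (entry Q x) p q
      = mat_mult (entry Q x) (entry Q (gradient Q f)) p q" if "arc_parallel Q p q" for p q
    using that
    by (simp add: mat_mult_def entry_gradient arc_parallel_def if_distrib if_distribR cong: if_cong)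
  then show "cochain_bracket Q Z x (gradient Q f) = 0" "cochain_bracket Q Z (gradient Q f) x = 0"
    using x by (auto intro!: arrow_cochain_eqI simp: bracket_simps gradient_arrow_cochain)
qed

section \<open>Cohomology as the quotient by gradients\<close>

lemma HH1_class_mem: "x' \<in> HH1_class Q Z x \<longleftrightarrow> (\<exists>f. x' = x + gradient Q f)"
  by (auto simp: HH1_class_def im_delta0_eq)

lemma HH1_class_self: "x \<in> HH1_class Q Z x"
  unfolding HH1_class_mem by (rule exI[of _ "\<lambda>_. 0"]) (simp add: gradient_simps)

lemma HH1_class_nonempty: "HH1_class Q Z x \<noteq> {}"
  using HH1_class_self by blast

lemma HH1_class_add_gradient: "HH1_class Q Z (x + gradient Q f) = HH1_class Q Z x"
proof (intro equalityI subsetI)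
  fix z assume "z \<in> HH1_class Q Z (x + gradient Q f)"
  then obtain g where "z = x + (gradient Q f + gradient Q g)"
    by (auto simp: HH1_class_mem add.assoc)
  then show "z \<in> HH1_class Q Z x" unfolding HH1_class_mem gradient_simps by blast
next
  fix z assume "z \<in> HH1_class Q Z x"
  then obtain g where "z = (x + gradient Q f) + (gradient Q g - gradient Q f)"
    by (auto simp: HH1_class_mem)
  then show "z \<in> HH1_class Q Z (x + gradient Q f)" unfolding HH1_class_mem gradient_simps by blast
qed

lemma HH1_class_eq_iff: "HH1_class Q Z x = HH1_class Q Z y \<longleftrightarrow> (\<exists>f. x = y + gradient Q f)"
  using HH1_class_self HH1_class_mem HH1_class_add_gradient by metis

text \<open>All representatives yield the same coset, so the union in the definition of
  \<open>HH1\<close> collapses to it; cosets being nonempty excludes the empty union.\<close>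

lemma HH1_add: "lie_add (HH1 Q Z) (HH1_class Q Z x) (HH1_class Q Z y) = HH1_class Q Z (x + y)"
proof -
  have "HH1_class Q Z (x' + y') = HH1_class Q Z (x + y)"
    if x': "x' \<in> HH1_class Q Z x" and y': "y' \<in> HH1_class Q Z y" for x' y'
  proof -
    obtain f g where "x' = x + gradient Q f" "y' = y + gradient Q g"
      using x' y' by (auto simp: HH1_class_mem)
    then have "x' + y' = (x + y) + gradient Q (\<lambda>v. f v + g v)"
      by (simp add: gradient_simps(2)[symmetric])
    then show ?thesis by (simp only: HH1_class_add_gradient)
  qed
  then show ?thesis by (simp add: HH1_def HH1_class_nonempty cong: SUP_cong)
qed

lemma HH1_scale: "lie_scale (HH1 Q Z) c (HH1_class Q Z x) = HH1_class Q Z (pm_scale c x)"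
proof -
  have "HH1_class Q Z (pm_scale c x') = HH1_class Q Z (pm_scale c x)"
    if x': "x' \<in> HH1_class Q Z x" for x'
  proof -
    obtain f where "x' = x + gradient Q f"
      using x' by (auto simp: HH1_class_mem)
    then have "pm_scale c x' = pm_scale c x + gradient Q (\<lambda>v. c * f v)"
      by (simp add: gradient_simps(4)[symmetric] poly_mapping_eq_iff fun_eq_iff lookup_add algebra_simps)
    then show ?thesis by (simp only: HH1_class_add_gradient)
  qed
  then show ?thesis by (simp add: HH1_def HH1_class_nonempty cong: SUP_cong)
qed

text \<open>As gradients are central, changing representatives does not even change the bracket of
  cochains.\<close>

lemma HH1_bracket:
  assumes "x \<in> free_space (arrow_pairs Q)" "y \<in> free_space (arrow_pairs Q)"
  shows "lie_bracket (HH1 Q Z) (HH1_class Q Z x) (HH1_class Q Z y)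
    = HH1_class Q Z (cochain_bracket Q Z x y)"
proof -
  have "cochain_bracket Q Z x' y' = cochain_bracket Q Z x y"
    if x': "x' \<in> HH1_class Q Z x" and y': "y' \<in> HH1_class Q Z y" for x' y'
  proof -
    obtain f g where "x' = x + gradient Q f" "y' = y + gradient Q g"
      using x' y' by (auto simp: HH1_class_mem)
    then show ?thesis using assms
      by (simp add: bracket_bilinear bracket_gradient gradient_arrow_cochain free_space_closed)
  qed
  then show ?thesis by (simp add: HH1_def HH1_class_nonempty cong: SUP_cong)
qed

lemma HH1_zero: "lie_zero (HH1 Q Z) = HH1_class Q Z 0"
  by (simp add: HH1_def)

lemma HH1_carrier:
  assumes "CHAR('k) = 0"
  shows "lie_carrier (HH1 Q Z :: ('k::field, ('v, 'a, 'k) cochain set) lie_data)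
    = HH1_class Q Z ` free_space (arrow_pairs Q)"
  by (simp add: HH1_def ker_delta1_eq[OF assms])

lemma HH1_lie_algebra:
  assumes "CHAR('k) = 0"
  shows "lie_algebra (HH1 Q Z :: ('k::field, ('v, 'a, 'k) cochain set) lie_data)"
proof -
  interpret V: vector_space "pm_scale :: 'k \<Rightarrow> ('v, 'a, 'k) cochain \<Rightarrow> _"
    by (rule vector_space_pm_scale)
  have neg: "\<exists>y\<in>free_space (arrow_pairs Q). HH1_class Q Z (x + y) = HH1_class Q Z 0"
    if "x \<in> free_space (arrow_pairs Q)" for x :: "('v, 'a, 'k) cochain"
    using that by (intro bexI[of _ "pm_scale (- 1) x"]) (simp_all add: pm_scale_uminus free_space_closed(4))
  note simps = HH1_carrier[OF assms] HH1_add HH1_scale HH1_bracket HH1_zero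
    free_space_closed bracket_arrow_cochain bracket_bilinear
    V.scale_right_distrib
    V.scale_left_distrib
    V.scale_scale
    V.scale_one
  show ?thesis
  \<comment> \<open>In the order of the axioms, the numbered goals are associativity, commutativity,
    additive inverses, \<open>[x, x] = 0\<close> and the Jacobi identity.\<close>
  proof (unfold_locales, goal_cases)
    case 5 then show ?case by (auto simp: simps add.assoc)
  next
    case 6 then show ?case by (auto simp: simps add.commute)
  next
    case 8 then show ?case using neg by (auto simp: simps)
  next
    case 17 then show ?case by (auto simp: simps bracket_self)
  next
    case 18 then show ?case by (auto simp: simps bracket_jacobi)
  qed (auto simp: simps)
qed

section \<open>Normalized traces and characters of walks\<close>

lemma average_bracket:
  assumes "x \<in> free_space (arrow_pairs Q)" "y \<in> free_space (arrow_pairs Q)"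
  shows "average Q c (cochain_bracket Q Z x y) = (0 :: 'k::field)"
proof -
  let ?C = "{a. arc_parallel Q a c}"
  have fin: "?C \<subseteq> arcs Q" by (auto simp: arc_parallel_def)
  \<comment> \<open>Entries between different classes vanish, so the diagonal of a product is
    computed inside one block; the claim becomes the vanishing of the trace of a commutator.\<close>
  have restrict: "mat_mult (entry Q u) (entry Q w) a a = (\<Sum>b\<in>?C. entry Q u a b * entry Q w b a)"
    if "u \<in> free_space (arrow_pairs Q)" "a \<in> ?C" for u w :: "('v, 'a, 'k) cochain" and a
    unfolding mat_mult_def
  proof (intro sum.mono_neutral_right ballI)
    fix b assume "b \<in> arcs Q - ?C"
    then have "\<not> arc_parallel Q a b" using that(2) by (auto simp: arc_parallel_def)
    then show "entry Q u a b * entry Q w b a = 0" by (simp add: entry_nonparallel[OF that(1)])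
  qed (use fin in auto)
  have "(\<Sum>a\<in>?C. mat_mult (entry Q y) (entry Q x) a a) = (\<Sum>a\<in>?C. \<Sum>b\<in>?C. entry Q y a b * entry Q x b a)"
    by (intro sum.cong refl restrict assms)
  also have "\<dots> = (\<Sum>b\<in>?C. \<Sum>a\<in>?C. entry Q x b a * entry Q y a b)"
    by (subst sum.swap) (simp only: mult.commute)
  also have "\<dots> = (\<Sum>a\<in>?C. mat_mult (entry Q x) (entry Q y) a a)"
    by (intro sum.cong refl restrict[symmetric] assms)
  finally show ?thesis
    using assms by (simp add: average_def entry_bracket_mat sum_subtractf)
qed

text \<open>A gradient is constant on the class of \<open>c\<close>. That class is finite and
  contains \<open>c\<close>, so its size is invertible in characteristic 0.\<close>

lemma average_gradient:
  assumes "CHAR('k) = 0" "c \<in> arcs Q"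
  shows "average Q c (gradient Q f) = (f (tail Q c) - f (head Q c) :: 'k::field)"
proof -
  let ?C = "{a. arc_parallel Q a c}"
  have "finite ?C" "c \<in> ?C"
    using assms by (auto simp: arc_parallel_def)
  then have "card ?C \<noteq> 0" by auto
  then have "(of_nat (card ?C) :: 'k) \<noteq> 0"
    using assms(1) by (simp add: of_nat_eq_0_iff_char_dvd)
  moreover have "(\<Sum>a\<in>?C. entry Q (gradient Q f) a a) = (\<Sum>a\<in>?C. f (tail Q c) - f (head Q c))"
    by (intro sum.cong refl) (auto simp: entry_gradient arc_parallel_def)
  ultimately show ?thesis by (simp add: average_def)
qed

text \<open>The averages over the arrows of a walk, signed by direction, telescope on gradients.\<close>

lemma walk_character:
  assumes "CHAR('k) = 0" "u \<rightarrow>\<^sup>*\<^bsub>mk_symmetric Q\<^esub> v"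
  obtains l :: "('v, 'a, 'k::field) cochain \<Rightarrow> 'k" where
    "\<And>x y. l (x + y) = l x + l y" "\<And>c x. l (pm_scale c x) = c * l x"
    "\<And>x y. x \<in> free_space (arrow_pairs Q) \<Longrightarrow> y \<in> free_space (arrow_pairs Q) \<Longrightarrow>
      l (cochain_bracket Q Z x y) = 0"
    "\<And>f. l (gradient Q f) = f u - f v"
proof -
  let ?P = "\<lambda>l v. (\<forall>x y. l (x + y) = l x + l y) \<and> (\<forall>c x. l (pm_scale c x) = c * l x) \<and>
    (\<forall>x\<in>free_space (arrow_pairs Q). \<forall>y\<in>free_space (arrow_pairs Q). l (cochain_bracket Q Z x y) = 0) \<and>
    (\<forall>f. l (gradient Q f) = (f u - f v :: 'k))"
  have "\<exists>l. ?P l v"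
    using assms(2) unfolding reachable_def
  proof (induction rule: rtrancl_on_induct)
    case base
    show ?case by (rule exI[of _ "\<lambda>_. 0"]) simp
  next
    case (step v w)
    then obtain l where l: "?P l v" by blast
    from step have "(v, w) \<in> (\<Union>e\<in>arcs Q. {(tail Q e, head Q e), (head Q e, tail Q e)})"
      by (simp add: parcs_mk_symmetric)
    then obtain c where c: "c \<in> arcs Q" "(v, w) = (tail Q c, head Q c) \<or> (v, w) = (head Q c, tail Q c)"
      by blast
    \<comment> \<open>The sign is 1 if \<open>c\<close> is traversed forwards and -1 if backwards;
      at a loop both differences are 0.\<close>
    have "\<exists>s :: 'k. \<forall>f. s * (f (tail Q c) - f (head Q c)) = f v - f w"
      using c(2) by (intro exI[of _ "if v = tail Q c then 1 else - 1"]) auto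
    then obtain s :: 'k where s: "\<And>f. s * (f (tail Q c) - f (head Q c)) = f v - f w" by blast
    have "l (x + y) + s * average Q c (x + y)
        = (l x + s * average Q c x) + (l y + s * average Q c y)" for x y
      using l by (simp add: average_add algebra_simps)
    moreover have "l (pm_scale d x) + s * average Q c (pm_scale d x) = d * (l x + s * average Q c x)" for d x
      using l by (simp add: average_scale algebra_simps)
    moreover have "l (gradient Q f) + s * average Q c (gradient Q f) = f u - f w" for f
      using l by (simp add: average_gradient[OF assms(1) c(1)] s)
    ultimately have "?P (\<lambda>x. l x + s * average Q c x) w"
      using l by (simp add: average_bracket)
    then show ?case by (intro exI)
  qed
  then show ?thesis using that by blast
qed

end


section \<open>Gluing two arrows\<close>

lemma lie_algebra_prod:
  assumes "lie_algebra L" "lie_algebra M"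
  shows "lie_algebra (L \<times>\<^sub>L M)"
proof -
  interpret L: lie_algebra L by fact
  interpret M: lie_algebra M by fact
  show ?thesis
  proof (unfold_locales, goal_cases)
    case 5 then show ?case by (auto simp: lie_prod_def L.add_assoc M.add_assoc)
  next
    case 6 then show ?case by (auto simp: lie_prod_def intro: L.add_commute M.add_commute)
  next
    case (8 x)
    then obtain y z where "y \<in> lie_carrier L" "lie_add L (fst x) y = lie_zero L"
      "z \<in> lie_carrier M" "lie_add M (snd x) z = lie_zero M"
      using L.add_inverse[of "fst x"] M.add_inverse[of "snd x"] by (auto simp: lie_prod_def)
    then show ?case by (intro bexI[of _ "(y, z)"]) (auto simp: lie_prod_def)
  next
    case 18 then show ?case by (auto simp: lie_prod_def L.jacobi M.jacobi)
  qed (auto simp: lie_prod_def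
      L.zero_closed L.add_closed L.scale_closed L.bracket_closed L.add_zero L.scale_add L.add_scale
      L.scale_scale L.scale_one L.bracket_add_left L.bracket_add_right L.bracket_scale_left
      L.bracket_scale_right L.bracket_self
      M.zero_closed M.add_closed M.scale_closed M.bracket_closed M.add_zero M.scale_add M.add_scale
      M.scale_scale M.scale_one M.bracket_add_left M.bracket_add_right M.bracket_scale_left
      M.bracket_scale_right M.bracket_self)
qed

lemma lie_algebra_abelian_line: "lie_algebra (abelian_line :: ('k::field, 'k) lie_data)"
proof (unfold_locales, goal_cases)
  case (8 x)
  then show ?case by (intro bexI[of _ "- x"]) (auto simp: abelian_line_def)
qed (auto simp: abelian_line_def algebra_simps)

section \<open>The glued quiver and special pairs of arrows\<close>

locale glued_quiver = rad_square_zero_quiver Q Z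
  for Q :: "('v, 'a) pre_digraph" and Z Z' :: "('v, 'a) path set" and \<alpha> \<beta> :: 'a +
  assumes glued_arcs: "\<alpha> \<in> arcs Q" "\<beta> \<in> arcs Q"
    and dist: "distinct [tail Q \<alpha>, head Q \<alpha>, tail Q \<beta>, head Q \<beta>]"
    and rsz': "radical_square_zero (glue_quiver Q \<alpha> \<beta>) Z'"
begin

abbreviation (input) "Q' \<equiv> glue_quiver Q \<alpha> \<beta>"
abbreviation (input) "gv \<equiv> glue_vertex Q \<alpha> \<beta>"
abbreviation (input) "ga \<equiv> glue_arrow \<alpha> \<beta>"

lemma gv_ga: "gv (tail Q (ga a)) = gv (tail Q a)" "gv (head Q (ga a)) = gv (head Q a)"
  using dist by (auto simp: glue_vertex_def glue_arrow_def)

lemma glue_quiver_simps [simp]: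
  "tail Q' a = gv (tail Q a)" "head Q' a = gv (head Q a)"
  "verts Q' = gv ` verts Q" "arcs Q' = ga ` arcs Q"
  by (simp_all add: glue_quiver_def)

sublocale B: rad_square_zero_quiver Q' Z'
  by unfold_locales (use rsz' in \<open>auto simp: gv_ga\<close>)

lemma ga_cases: "ga \<alpha> = \<alpha>" "ga \<beta> = \<alpha>" "a \<noteq> \<beta> \<Longrightarrow> ga a = a"
  by (auto simp: glue_arrow_def)

lemma glue_path_arrow: "glue_path Q \<alpha> \<beta> (arrow_path Q a) = arrow_path Q' (ga a)"
  by (simp add: glue_path_def arrow_path_def gv_ga)

lemma glue_parallel: "arc_parallel Q a b \<Longrightarrow> arc_parallel Q' (ga a) (ga b)"
  by (auto simp: arc_parallel_def gv_ga)

lemma glue_vertex_eqD: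
  "gv u = gv v \<Longrightarrow> u \<notin> {tail Q \<alpha>, head Q \<alpha>, tail Q \<beta>, head Q \<beta>} \<Longrightarrow> v = u"
  by (auto simp: glue_vertex_def split: if_splits)

text \<open>Gluing is injective away from the four end points, so two arrows can become parallel
  only if \<open>a\<close> touches one of them; this is condition (1). The assumptions
  \<open>ne\<close> and \<open>not_exceptional\<close> supply (3) and (4).\<close>

lemma special_pair_arrows:
  assumes ab: "a \<in> arcs Q" "b \<in> arcs Q" "arc_parallel Q' (ga a) (ga b)" "\<not> arc_parallel Q a b"
    and ne: "ga a \<noteq> \<alpha> \<or> ga b \<noteq> \<alpha>"
    and not_exceptional: "\<not> (a = \<alpha> \<and> arc_parallel Q b \<beta>)" "\<not> (a = \<beta> \<and> arc_parallel Q b \<alpha>)"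
      "\<not> (b = \<alpha> \<and> arc_parallel Q a \<beta>)" "\<not> (b = \<beta> \<and> arc_parallel Q a \<alpha>)"
  shows "(a, arrow_path Q b) \<in> special_pairs Q Z \<alpha> \<beta>"
proof -
  have "{tail Q a, head Q a} \<inter> {tail Q \<alpha>, head Q \<alpha>, tail Q \<beta>, head Q \<beta>} \<noteq> {}"
  proof
    assume "{tail Q a, head Q a} \<inter> {tail Q \<alpha>, head Q \<alpha>, tail Q \<beta>, head Q \<beta>} = {}"
    then have "tail Q b = tail Q a" "head Q b = head Q a"
      using ab(3) glue_vertex_eqD[of "tail Q a" "tail Q b"] glue_vertex_eqD[of "head Q a" "head Q b"]
      by (auto simp: arc_parallel_def gv_ga)
    then show False using ab by (simp add: arc_parallel_def)
  qed
  moreover have "parallel Q' (glue_path Q \<alpha> \<beta> (arrow_path Q a)) (glue_path Q \<alpha> \<beta> (arrow_path Q b))"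
    using ab(3) by (simp add: glue_path_arrow parallel_def arc_parallel_def)
  moreover have "(glue_path Q \<alpha> \<beta> (arrow_path Q a), glue_path Q \<alpha> \<beta> (arrow_path Q b))
      \<noteq> (glue_path Q \<alpha> \<beta> (arrow_path Q \<alpha>), glue_path Q \<alpha> \<beta> (arrow_path Q \<alpha>))"
    using ne by (simp add: glue_path_arrow ga_cases)
  moreover have "parallel Q (arrow_path Q c) (arrow_path Q d) \<longleftrightarrow> arc_parallel Q c d"
    if "c \<in> arcs Q" "d \<in> arcs Q" for c d
    using that by (simp add: parallel_def arc_parallel_def)
  ultimately show ?thesis
    using ab not_exceptional glued_arcs by (simp add: special_pairs_def basis)
qed

text \<open>A pair of parallel arrows of the glued quiver is a cocycle, so a special pair of arrows
  would give a nonzero basis vector in \<open>Z_spp\<close>.\<close>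

lemma not_special_pair_arrows:
  assumes Z_spp: "Z_spp Q Z Z' \<alpha> \<beta> = {0 :: ('v, 'a, 'k::field) cochain}" and char: "CHAR('k) = 0"
    and b: "b \<in> arcs Q"
  shows "(a, arrow_path Q b) \<notin> special_pairs Q Z \<alpha> \<beta>"
proof
  interpret V: vector_space "pm_scale :: 'k \<Rightarrow> ('v, 'a, 'k) cochain \<Rightarrow> _"
    by (rule vector_space_pm_scale)
  assume sp: "(a, arrow_path Q b) \<in> special_pairs Q Z \<alpha> \<beta>"
  let ?x = "Poly_Mapping.single (glue_path Q \<alpha> \<beta> (arrow_path Q a), glue_path Q \<alpha> \<beta> (arrow_path Q b)) 1
    :: ('v, 'a, 'k) cochain"
  have "?x \<in> V.span ((\<lambda>(a, p). Poly_Mapping.single (glue_path Q \<alpha> \<beta> (arrow_path Q a), glue_path Q \<alpha> \<beta> p) 1)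
          ` special_pairs Q Z \<alpha> \<beta>)"
    by (intro V.span_base image_eqI[OF _ sp]) simp
  moreover have "?x \<in> ker_delta1 Q' Z'"
    using sp b unfolding B.ker_delta1_eq[OF char]
    by (auto simp: free_space_def arrow_pairs_def arc_parallel_def special_pairs_def parallel_def
        glue_path_arrow gv_ga)
  ultimately have "?x \<in> Z_spp Q Z Z' \<alpha> \<beta>" by (simp add: Z_spp_def)
  then show False
    unfolding Z_spp by (metis lookup_single_eq lookup_zero one_neq_zero singletonD)
qed

end

section \<open>Lifting cocycles from the glued algebra\<close>

text \<open>
  The last two assumptions hold, for a suitable choice of \<open>\<mu>\<close>, when no special pair consists of arrows.
\<close>

locale glued_singleton = glued_quiver Q Z Z' \<alpha> \<beta>
  for Q :: "('v, 'a) pre_digraph" and Z Z' :: "('v, 'a) path set" and \<alpha> \<beta> :: 'a +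
  fixes \<mu> \<nu> :: 'a
  assumes munu: "\<mu> = \<beta> \<and> \<nu> = \<alpha> \<or> \<mu> = \<alpha> \<and> \<nu> = \<beta>"
    and singleton: "arc_parallel Q a \<mu> \<Longrightarrow> a = \<mu>"
    and unglue_parallel: "a \<in> arcs Q - {\<mu>} \<Longrightarrow> b \<in> arcs Q - {\<mu>} \<Longrightarrow>
      arc_parallel Q' (ga a) (ga b) \<Longrightarrow> arc_parallel Q a b"
begin

lemma munu_arcs: "\<mu> \<in> arcs Q" "\<nu> \<in> arcs Q - {\<mu>}" "ga \<mu> = \<alpha>" "ga \<nu> = \<alpha>" "\<not> arc_parallel Q \<mu> \<nu>"
  using munu glued_arcs dist by (auto simp: ga_cases arc_parallel_def)

lemma ga_bij: "bij_betw ga (arcs Q - {\<mu>}) (arcs Q')"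
proof -
  have "inj_on ga (arcs Q - {\<mu>})"
    using munu by (auto simp: inj_on_def glue_arrow_def)
  moreover have "ga ` (arcs Q - {\<mu>}) = arcs Q'"
    using munu_arcs by (auto simp: image_iff) (metis Diff_iff singletonD)+
  ultimately show ?thesis by (simp add: bij_betw_def)
qed

text \<open>The inverse of the bijection \<open>ga\<close> on \<open>arcs Q - {\<mu>}\<close>;
  recall that \<alpha> also names the glued arrow.\<close>

definition section_arc :: "'a \<Rightarrow> 'a" where
  "section_arc p = (if p = \<alpha> then \<nu> else p)"

lemma section_arc: "p \<in> arcs Q' \<Longrightarrow> section_arc p \<in> arcs Q - {\<mu>} \<and> ga (section_arc p) = p"
  using munu_arcs munu by (auto simp: section_arc_def glue_arrow_def)

lemma section_ga: "a \<in> arcs Q - {\<mu>} \<Longrightarrow> section_arc (ga a) = a"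
  using munu by (auto simp: section_arc_def glue_arrow_def)

text \<open>
  Putting the average of the diagonal entries of the class of \<open>\<nu>\<close> at \<open>\<mu> \<parallel> \<mu>\<close> makes lifting commute with
  gradients; it is a Lie homomorphism because averages vanish on brackets.
\<close>

definition lift :: "('v, 'a, 'k::field) cochain \<Rightarrow> ('v, 'a, 'k) cochain" where
  "lift x = cochain_of (\<lambda>a b. if a = \<mu> \<or> b = \<mu> then (if a = b then average Q' \<alpha> x else 0)
     else entry Q' x (ga a) (ga b))"

lemma lift_arrow_cochain: "lift x \<in> free_space (arrow_pairs Q)"
  by (simp add: lift_def cochain_of_arrow_cochain)

lemma entry_lift_mu: "entry Q (lift x) \<mu> \<mu> = average Q' \<alpha> x"
  using munu_arcs by (simp add: lift_def entry_cochain_of arc_parallel_def)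

lemma entry_lift_mixed: "b \<noteq> \<mu> \<Longrightarrow> entry Q (lift x) \<mu> b = 0" "b \<noteq> \<mu> \<Longrightarrow> entry Q (lift x) b \<mu> = 0"
  by (simp_all add: lift_def entry_cochain_of)

text \<open>\<open>cochain_of\<close> drops non-parallel pairs, but nothing is lost: arrows other
  than \<mu> that are parallel after gluing were parallel before.\<close>

lemma entry_lift:
  assumes "x \<in> free_space (arrow_pairs Q')" "a \<in> arcs Q - {\<mu>}" "b \<in> arcs Q - {\<mu>}"
  shows "entry Q (lift x) a b = entry Q' x (ga a) (ga b)"
  using assms unglue_parallel B.entry_nonparallel[OF assms(1)]
  by (auto simp: lift_def entry_cochain_of)

text \<open>As \<mu> is alone in its class, a cochain is determined by its entry at \<mu> and its
  entries away from \<mu>.\<close>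

lemma lift_eqI:
  assumes "y \<in> free_space (arrow_pairs Q)" "entry Q (lift x) \<mu> \<mu> = entry Q y \<mu> \<mu>"
    and "\<And>a b. a \<in> arcs Q - {\<mu>} \<Longrightarrow> b \<in> arcs Q - {\<mu>} \<Longrightarrow> arc_parallel Q a b \<Longrightarrow>
      entry Q (lift x) a b = entry Q y a b"
  shows "lift x = y"
proof (rule arrow_cochain_eqI[OF lift_arrow_cochain assms(1)])
  fix a b assume ab: "arc_parallel Q a b"
  then have "arc_parallel Q b a" by (simp add: arc_parallel_def)
  then have "a = \<mu> \<longleftrightarrow> b = \<mu>" using ab singleton by auto
  then show "entry Q (lift x) a b = entry Q y a b"
    using assms(2,3) ab by (cases "a = \<mu>") (auto simp: arc_parallel_def)
qed

lemma lift_add: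
  assumes "x \<in> free_space (arrow_pairs Q')" "y \<in> free_space (arrow_pairs Q')"
  shows "lift (x + y) = lift x + lift y"
  using assms
  by (intro lift_eqI) (auto simp: entry_lift_mu entry_lift free_space_closed lift_arrow_cochain average_add)

lemma lift_scale:
  assumes "x \<in> free_space (arrow_pairs Q')"
  shows "lift (pm_scale c x) = pm_scale c (lift x)"
  using assms
  by (intro lift_eqI) (auto simp: entry_lift_mu entry_lift free_space_closed lift_arrow_cochain average_scale)

lemma mat_mult_lift_mu:
  "mat_mult (entry Q (lift x)) (entry Q (lift y)) \<mu> \<mu> = average Q' \<alpha> x * average Q' \<alpha> y"
proof -
  have "mat_mult (entry Q (lift x)) (entry Q (lift y)) \<mu> \<mu>
      = (\<Sum>c\<in>arcs Q. if c = \<mu> then average Q' \<alpha> x * average Q' \<alpha> y else 0)"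
    unfolding mat_mult_def by (intro sum.cong refl) (auto simp: entry_lift_mu entry_lift_mixed)
  then show ?thesis using munu_arcs by simp
qed

text \<open>A lift is block diagonal, with a block of size one at \<mu> and a copy of
  \<open>x\<close> transported along \<open>ga\<close>, so products are formed blockwise.\<close>

lemma mat_mult_lift:
  assumes "x \<in> free_space (arrow_pairs Q')" "y \<in> free_space (arrow_pairs Q')"
    and "a \<in> arcs Q - {\<mu>}" "b \<in> arcs Q - {\<mu>}"
  shows "mat_mult (entry Q (lift x)) (entry Q (lift y)) a b
    = B.mat_mult (entry Q' x) (entry Q' y) (ga a) (ga b)"
proof -
  have "mat_mult (entry Q (lift x)) (entry Q (lift y)) a b
      = (\<Sum>c\<in>arcs Q - {\<mu>}. entry Q (lift x) a c * entry Q (lift y) c b)"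
    unfolding mat_mult_def using assms
    by (intro sum.mono_neutral_right) (auto simp: entry_lift_mixed)
  also have "\<dots> = (\<Sum>c\<in>arcs Q - {\<mu>}. entry Q' x (ga a) (ga c) * entry Q' y (ga c) (ga b))"
    using assms by (intro sum.cong refl) (simp add: entry_lift)
  also have "\<dots> = B.mat_mult (entry Q' x) (entry Q' y) (ga a) (ga b)"
    unfolding B.mat_mult_def by (rule sum.reindex_bij_betw[OF ga_bij])
  finally show ?thesis .
qed

lemma lift_bracket:
  assumes "x \<in> free_space (arrow_pairs Q')" "y \<in> free_space (arrow_pairs Q')"
  shows "lift (cochain_bracket Q' Z' x y) = cochain_bracket Q Z (lift x) (lift y)"
proof (rule lift_eqI)
  show "cochain_bracket Q Z (lift x) (lift y) \<in> free_space (arrow_pairs Q)"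
    by (intro bracket_arrow_cochain lift_arrow_cochain)
  \<comment> \<open>Both sides are 0: the left one as an average of a bracket, the right one as a
    commutator of scalars.\<close>
  show "entry Q (lift (cochain_bracket Q' Z' x y)) \<mu> \<mu> = entry Q (cochain_bracket Q Z (lift x) (lift y)) \<mu> \<mu>"
    by (simp add: entry_lift_mu B.average_bracket assms entry_bracket_mat lift_arrow_cochain mat_mult_lift_mu
        mult.commute)
  fix a b assume ab: "a \<in> arcs Q - {\<mu>}" "b \<in> arcs Q - {\<mu>}"
  show "entry Q (lift (cochain_bracket Q' Z' x y)) a b = entry Q (cochain_bracket Q Z (lift x) (lift y)) a b"
    unfolding entry_lift[OF B.bracket_arrow_cochain[OF assms] ab] B.entry_bracket_mat[OF assms]
      entry_bracket_mat[OF lift_arrow_cochain lift_arrow_cochain]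
      mat_mult_lift[OF assms ab] mat_mult_lift[OF assms(2,1) ab] ..
qed

text \<open>At \<mu> this holds because the average of a gradient over the class of the glued arrow
  is its value there, and \<mu> has the same glued ends. Elsewhere \<open>ga\<close> is injective,
  so diagonal entries correspond.\<close>

lemma lift_gradient:
  assumes "CHAR('k) = 0"
  shows "lift (gradient Q' f) = (gradient Q (\<lambda>v. f (gv v)) :: ('v, 'a, 'k::field) cochain)"
proof (rule lift_eqI[OF gradient_arrow_cochain])
  have "gv (tail Q \<mu>) = gv (tail Q \<alpha>)" "gv (head Q \<mu>) = gv (head Q \<alpha>)"
    using gv_ga munu_arcs(3) by metis+
  moreover have "\<alpha> \<in> arcs Q'" using imageI[OF munu_arcs(1), of ga] munu_arcs(3) by simp
  ultimately show "entry Q (lift (gradient Q' f)) \<mu> \<mu> = entry Q (gradient Q (\<lambda>v. f (gv v))) \<mu> \<mu>"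
    using B.average_gradient[OF assms, of \<alpha> f] munu_arcs(1)
    by (simp only: entry_lift_mu entry_gradient glue_quiver_simps) simp
next
  fix a b assume ab: "a \<in> arcs Q - {\<mu>}" "b \<in> arcs Q - {\<mu>}"
  have "ga a = ga b \<longleftrightarrow> a = b" using section_ga ab by metis
  then show "entry Q (lift (gradient Q' f)) a b = entry Q (gradient Q (\<lambda>v. f (gv v))) a b"
    using ab by (simp add: entry_lift[OF B.gradient_arrow_cochain ab] B.entry_gradient entry_gradient gv_ga)
qed

text \<open>Gluing maps the class of \<nu>, which avoids \<mu>, bijectively onto the class of the
  glued arrow, so both averages run over the same entries.\<close>

lemma average_lift:
  assumes "x \<in> free_space (arrow_pairs Q')"
  shows "average Q \<nu> (lift x) = average Q' \<alpha> x"
proof -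
  let ?C = "{a. arc_parallel Q a \<nu>}" and ?C' = "{p. arc_parallel Q' p \<alpha>}"
  have sub: "?C \<subseteq> arcs Q - {\<mu>}"
    using munu_arcs by (auto simp: arc_parallel_def)
  have bij: "bij_betw ga ?C ?C'"
    unfolding bij_betw_def
  proof (intro conjI equalityI subsetI)
    show "inj_on ga ?C" using ga_bij sub by (auto simp: bij_betw_def intro: inj_on_subset)
    show "p \<in> ?C'" if "p \<in> ga ` ?C" for p
      using that glue_parallel munu_arcs(4) by auto metis
    show "p \<in> ga ` ?C" if "p \<in> ?C'" for p
    proof -
      have "p \<in> arcs Q'" using that by (simp add: arc_parallel_def)
      then have "section_arc p \<in> arcs Q - {\<mu>}" "ga (section_arc p) = p" using section_arc by auto
      moreover from this have "arc_parallel Q (section_arc p) \<nu>"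
        using that munu_arcs unglue_parallel by auto
      ultimately show ?thesis by (metis image_eqI mem_Collect_eq)
    qed
  qed
  have "(\<Sum>a\<in>?C. entry Q (lift x) a a) = (\<Sum>a\<in>?C. entry Q' x (ga a) (ga a))"
    using sub assms by (intro sum.cong refl entry_lift) auto
  also have "\<dots> = (\<Sum>p\<in>?C'. entry Q' x p p)"
    by (rule sum.reindex_bij_betw[OF bij])
  finally show ?thesis
    by (simp add: average_def bij_betw_same_card[OF bij])
qed

lemma lift_inj:
  assumes "x \<in> free_space (arrow_pairs Q')" "y \<in> free_space (arrow_pairs Q')" "lift x = lift y"
  shows "x = y"
proof (rule B.arrow_cochain_eqI[OF assms(1,2)])
  fix p q assume "arc_parallel Q' p q"
  then have "p \<in> arcs Q'" "q \<in> arcs Q'" by (auto simp: arc_parallel_def)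
  then show "entry Q' x p q = entry Q' y p q"
    using entry_lift[OF assms(1)] entry_lift[OF assms(2)] assms(3) section_arc by metis
qed

text \<open>By \<open>average_lift\<close> and \<open>entry_lift_mu\<close> every lift satisfies the
  condition on averages; here it is shown to characterize the lifts.\<close>

lemma lift_surj:
  assumes y: "y \<in> free_space (arrow_pairs Q)" "average Q \<nu> y = entry Q y \<mu> \<mu>"
  obtains x where "x \<in> free_space (arrow_pairs Q')" "lift x = y"
proof
  let ?x = "B.cochain_of (\<lambda>p q. entry Q y (section_arc p) (section_arc q))"
  show x: "?x \<in> free_space (arrow_pairs Q')" by (rule B.cochain_of_arrow_cochain)
  have off: "entry Q (lift ?x) a b = entry Q y a b"
    if "a \<in> arcs Q - {\<mu>}" "b \<in> arcs Q - {\<mu>}" "arc_parallel Q a b" for a b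
    using that glue_parallel by (simp add: entry_lift[OF x] B.entry_cochain_of section_ga)
  \<comment> \<open>This average only involves entries away from \<mu>, where the two cochains
    agree; it then forces agreement at \<mu> too.\<close>
  have "average Q \<nu> (lift ?x) = average Q \<nu> y"
    unfolding average_def using munu_arcs
    by (intro arg_cong2[where f = "(/)"] sum.cong refl off) (auto simp: arc_parallel_def)
  then show "lift ?x = y"
    using y off by (intro lift_eqI) (simp_all add: entry_lift_mu average_lift[OF x])
qed

section \<open>The isomorphism of Lie algebras\<close>

lemma HH1_isomorphic:
  assumes char: "CHAR('k) = 0" and block: "same_block Q \<alpha> \<beta>"
  shows "(HH1 Q' Z' :: ('k::field, ('v, 'a, 'k) cochain set) lie_data)
    \<simeq>\<^sub>L (HH1 Q Z :: ('k, ('v, 'a, 'k) cochain set) lie_data) \<times>\<^sub>L abelian_line"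
proof -
  let ?C = "free_space (arrow_pairs Q) :: ('v, 'a, 'k) cochain set"
  let ?C' = "free_space (arrow_pairs Q') :: ('v, 'a, 'k) cochain set"
  obtain l :: "('v, 'a, 'k) cochain \<Rightarrow> 'k" where
    l_add: "\<And>x y. l (x + y) = l x + l y" and l_scale: "\<And>c x. l (pm_scale c x) = c * l x" and
    l_bracket: "\<And>x y. x \<in> ?C \<Longrightarrow> y \<in> ?C \<Longrightarrow> l (cochain_bracket Q Z x y) = 0" and
    l_gradient: "\<And>f. l (gradient Q f) = f (tail Q \<alpha>) - f (tail Q \<beta>)"
    using walk_character[OF char] block unfolding same_block_def by blast
  define \<Phi> where "\<Phi> x = (HH1_class Q Z (lift x), l (lift x))" for x
  \<comment> \<open>This gives both well-definedness and injectivity on classes. A gradient of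
    \<open>g\<close> is lifted from the glued quiver once \<open>g\<close> agrees at the two glued
    sources and at the two glued targets.\<close>
  have \<Phi>_eq_iff: "\<Phi> x = \<Phi> y \<longleftrightarrow> HH1_class Q' Z' x = HH1_class Q' Z' y" if xy: "x \<in> ?C'" "y \<in> ?C'" for x y
  proof
    assume "HH1_class Q' Z' x = HH1_class Q' Z' y"
    then obtain f where "x = y + gradient Q' f" unfolding B.HH1_class_eq_iff by blast
    then have "lift x = lift y + gradient Q (\<lambda>v. f (gv v))"
      using xy by (simp add: lift_add B.gradient_arrow_cochain lift_gradient[OF char])
    then show "\<Phi> x = \<Phi> y"
      \<comment> \<open>The function \<open>f (gv v)\<close> takes equal values at the sources of
        \<alpha> and \<beta>, so \<open>l\<close> does not see its gradient.\<close>
      using dist by (simp add: \<Phi>_def HH1_class_add_gradient l_add l_gradient glue_vertex_def)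
  next
    assume "\<Phi> x = \<Phi> y"
    then obtain g where g: "lift x = lift y + gradient Q g" and "l (lift x) = l (lift y)"
      by (auto simp: \<Phi>_def HH1_class_eq_iff)
    then have g1: "g (tail Q \<alpha>) = g (tail Q \<beta>)" by (simp add: l_add l_gradient)
    \<comment> \<open>The character \<open>l\<close> has given agreement at the sources. For lifts
      the entry at \<mu> equals the average at \<nu>, so \<open>g\<close> has the same difference
      along both arrows and agrees at the targets as well.\<close>
    have "average Q' \<alpha> x = average Q' \<alpha> y + (g (tail Q \<mu>) - g (head Q \<mu>))"
      using arg_cong[OF g, of "\<lambda>z. entry Q z \<mu> \<mu>"] munu_arcs
      by (simp add: entry_lift_mu entry_gradient)
    moreover have "average Q' \<alpha> x = average Q' \<alpha> y + (g (tail Q \<nu>) - g (head Q \<nu>))"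
      using arg_cong[OF g, of "average Q \<nu>"] munu_arcs xy
      by (simp add: average_lift average_add average_gradient[OF char])
    ultimately have "g (tail Q \<mu>) - g (head Q \<mu>) = g (tail Q \<nu>) - g (head Q \<nu>)" by simp
    then have "g (head Q \<alpha>) = g (head Q \<beta>)" using g1 munu by auto
    then have "g (gv v) = g v" for v using g1 by (auto simp: glue_vertex_def)
    then have lift_eq: "lift x = lift (y + gradient Q' g)"
      using g xy by (simp add: lift_add B.gradient_arrow_cochain lift_gradient[OF char])
    then have "x = y + gradient Q' g"
      by (rule lift_inj[OF xy(1) free_space_closed(2)[OF xy(2) B.gradient_arrow_cochain]])
    then show "HH1_class Q' Z' x = HH1_class Q' Z' y" unfolding B.HH1_class_eq_iff by blast
  qed
  have \<Phi>_surj: "\<exists>x\<in>?C'. \<Phi> x = (HH1_class Q Z y, c)" if y: "y \<in> ?C" for y c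
  proof -
    \<comment> \<open>A gradient supported at the ends of \<mu> adjusts \<open>y\<close> within its
      class: \<open>s\<close> at the source makes \<open>l\<close> equal to \<open>c\<close>, its
      sign depending on whether \<mu> is \<alpha> or \<beta>. Then \<open>t\<close> at the target
      makes the entry at \<mu> equal the average at \<nu>, which is unchanged.\<close>
    define s where "s = (if \<mu> = \<beta> then l y - c else c - l y)"
    define t where "t = entry Q y \<mu> \<mu> + s - average Q \<nu> y"
    define g where "g v = (if v = tail Q \<mu> then s else if v = head Q \<mu> then t else 0)" for v
    let ?y = "y + gradient Q g"
    have g: "g (tail Q \<mu>) = s" "g (head Q \<mu>) = t" "g (tail Q \<nu>) = 0" "g (head Q \<nu>) = 0"
      using munu dist by (auto simp: g_def)
    have "l ?y = c"
      using munu g dist by (auto simp: l_add l_gradient s_def)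
    have "average Q \<nu> ?y = entry Q ?y \<mu> \<mu>"
      using munu_arcs g by (simp add: average_add average_gradient[OF char] entry_gradient t_def)
    with lift_surj[of ?y] obtain x where "x \<in> ?C'" "lift x = ?y"
      using y by (auto simp: free_space_closed gradient_arrow_cochain)
    with \<open>l ?y = c\<close> show ?thesis
      by (intro bexI[of _ x]) (simp_all add: \<Phi>_def HH1_class_add_gradient)
  qed
  \<comment> \<open>The choice of representative is immaterial by
    \<open>\<Phi>_eq_iff\<close>.\<close>
  define \<phi> where "\<phi> X = \<Phi> (SOME x. x \<in> ?C' \<and> HH1_class Q' Z' x = X)" for X
  have \<phi>: "\<phi> (HH1_class Q' Z' x) = \<Phi> x" if "x \<in> ?C'" for x
  proof -
    let ?s = "SOME y. y \<in> ?C' \<and> HH1_class Q' Z' y = HH1_class Q' Z' x"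
    have "?s \<in> ?C' \<and> HH1_class Q' Z' ?s = HH1_class Q' Z' x"
      by (rule someI[of _ x]) (simp add: that)
    then show ?thesis using \<Phi>_eq_iff[of ?s x] that unfolding \<phi>_def by blast
  qed
  have carrier: "lie_carrier (HH1 Q Z \<times>\<^sub>L (abelian_line :: ('k, 'k) lie_data))
      = HH1_class Q Z ` ?C \<times> UNIV"
    by (simp add: lie_prod_def abelian_line_def HH1_carrier[OF char])
  have "bij_betw \<phi> (lie_carrier (HH1 Q' Z')) (lie_carrier (HH1 Q Z \<times>\<^sub>L abelian_line))"
    unfolding bij_betw_def
  proof (intro conjI equalityI subsetI)
    show "inj_on \<phi> (lie_carrier (HH1 Q' Z'))"
      unfolding B.HH1_carrier[OF char] by (auto intro!: inj_onI simp: \<phi> \<Phi>_eq_iff)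
    show "X \<in> lie_carrier (HH1 Q Z \<times>\<^sub>L abelian_line)" if "X \<in> \<phi> ` lie_carrier (HH1 Q' Z')" for X
      using that unfolding carrier B.HH1_carrier[OF char] by (auto simp: \<phi> \<Phi>_def lift_arrow_cochain)
    show "X \<in> \<phi> ` lie_carrier (HH1 Q' Z')" if X: "X \<in> lie_carrier (HH1 Q Z \<times>\<^sub>L abelian_line)" for X
    proof -
      obtain y c where "y \<in> ?C" "X = (HH1_class Q Z y, c)" using X unfolding carrier by auto
      with \<Phi>_surj obtain x where "x \<in> ?C'" "\<Phi> x = X" by blast
      then show ?thesis unfolding B.HH1_carrier[OF char] using \<phi> by (metis image_eqI)
    qed
  qed
  moreover have "\<phi> (lie_add (HH1 Q' Z') X Y) = lie_add (HH1 Q Z \<times>\<^sub>L abelian_line) (\<phi> X) (\<phi> Y) \<and>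
      \<phi> (lie_bracket (HH1 Q' Z') X Y) = lie_bracket (HH1 Q Z \<times>\<^sub>L abelian_line) (\<phi> X) (\<phi> Y)"
    if XY: "X \<in> lie_carrier (HH1 Q' Z')" "Y \<in> lie_carrier (HH1 Q' Z')" for X Y
  proof -
    obtain x y where "x \<in> ?C'" "X = HH1_class Q' Z' x" "y \<in> ?C'" "Y = HH1_class Q' Z' y"
      using XY unfolding B.HH1_carrier[OF char] by auto
    then show ?thesis
      by (simp add: B.HH1_add B.HH1_bracket \<phi> \<Phi>_def free_space_closed B.bracket_arrow_cochain
          lie_prod_def abelian_line_def HH1_add HH1_bracket lift_add lift_bracket lift_arrow_cochain
          l_add l_bracket)
  qed
  moreover have "\<phi> (lie_scale (HH1 Q' Z') c X) = lie_scale (HH1 Q Z \<times>\<^sub>L abelian_line) c (\<phi> X)"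
    if X: "X \<in> lie_carrier (HH1 Q' Z')" for c X
  proof -
    obtain x where "x \<in> ?C'" "X = HH1_class Q' Z' x"
      using X unfolding B.HH1_carrier[OF char] by auto
    then show ?thesis
      by (simp add: B.HH1_scale \<phi> \<Phi>_def free_space_closed lie_prod_def abelian_line_def HH1_scale
          lift_scale l_scale)
  qed
  ultimately have "\<phi> \<in> lie_iso (HH1 Q' Z') (HH1 Q Z \<times>\<^sub>L abelian_line)"
    unfolding lie_iso_def by blast
  then have "lie_iso (HH1 Q' Z' :: ('k, ('v, 'a, 'k) cochain set) lie_data) (HH1 Q Z \<times>\<^sub>L abelian_line) \<noteq> {}"
    by (metis empty_iff)
  then show ?thesis
    unfolding lie_isomorphic_def
    by (intro conjI B.HH1_lie_algebra HH1_lie_algebra lie_algebra_prod lie_algebra_abelian_line char)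
qed

end

section \<open>Absence of special pairs isolates one of the glued arrows\<close>

theorem corollary3p24:
  fixes Q :: "('v, 'a) pre_digraph" and Z Z\<^sub>B :: "('v, 'a) path set" and \<alpha> \<beta> :: 'a
  assumes "monomial_algebra Q Z"
    and "radical_square_zero Q Z"
    and "\<alpha> \<in> arcs Q" and "\<beta> \<in> arcs Q"
    and "distinct [tail Q \<alpha>, head Q \<alpha>, tail Q \<beta>, head Q \<beta>]"
    and "same_block Q \<alpha> \<beta>"
    and "radical_square_zero (glue_quiver Q \<alpha> \<beta>) Z\<^sub>B"
    and "(Z_spp Q Z Z\<^sub>B \<alpha> \<beta> :: ('v, 'a, 'k::field) cochain set) = {0}"
    and "CHAR('k) = 0"
  shows "(HH1 (glue_quiver Q \<alpha> \<beta>) Z\<^sub>B :: ('k, ('v, 'a, 'k) cochain set) lie_data)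
           \<simeq>\<^sub>L (HH1 Q Z :: ('k, ('v, 'a, 'k) cochain set) lie_data) \<times>\<^sub>L abelian_line"
proof -
  interpret fin_digraph Q using assms(1) by (simp add: monomial_algebra_def)
  interpret glued_quiver Q Z Z\<^sub>B \<alpha> \<beta> by unfold_locales (use assms in auto)
  note not_special = not_special_pair_arrows[OF assms(8,9)]
  \<comment> \<open>If both classes had a second arrow, two such arrows would become parallel only
    through gluing and form a special pair.\<close>
  have no_common: "a = \<alpha> \<or> b = \<beta>" if a: "arc_parallel Q a \<alpha>" and b: "arc_parallel Q b \<beta>" for a b
  proof (rule ccontr)
    assume ne: "\<not> (a = \<alpha> \<or> b = \<beta>)"
    then have "a \<noteq> \<beta>" "b \<noteq> \<alpha>" "\<not> arc_parallel Q a b" "a \<in> arcs Q" "b \<in> arcs Q"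
      using a b assms(5) by (auto simp: arc_parallel_def)
    moreover have "arc_parallel Q' (ga a) (ga b)"
      using glue_parallel[OF a] glue_parallel[OF b] by (simp add: ga_cases arc_parallel_def)
    ultimately show False
      using special_pair_arrows[of a b] not_special ne ga_cases by metis
  qed
  \<comment> \<open>Hence one of the two classes is a singleton; its arrow is taken as
    \<mu>.\<close>
  have "\<exists>\<mu> \<nu>. (\<mu> = \<beta> \<and> \<nu> = \<alpha> \<or> \<mu> = \<alpha> \<and> \<nu> = \<beta>) \<and> (\<forall>a. arc_parallel Q a \<mu> \<longrightarrow> a = \<mu>)"
    using no_common by metis
  then obtain \<mu> \<nu> where munu: "\<mu> = \<beta> \<and> \<nu> = \<alpha> \<or> \<mu> = \<alpha> \<and> \<nu> = \<beta>"
    and singleton: "\<And>a. arc_parallel Q a \<mu> \<Longrightarrow> a = \<mu>" by blast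
  \<comment> \<open>Otherwise \<open>a\<close> and \<open>b\<close> form a special pair: each
    exception in condition (4) involves \<mu> or an arrow parallel to \<mu>, that is, \<mu> itself.
    Both cannot glue to \<alpha>, as only \<nu> is left to do so.\<close>
  have "arc_parallel Q a b"
    if ab: "a \<in> arcs Q - {\<mu>}" "b \<in> arcs Q - {\<mu>}" "arc_parallel Q' (ga a) (ga b)" for a b
  proof (rule ccontr)
    assume np: "\<not> arc_parallel Q a b"
    then have "a \<noteq> b" using ab by (auto simp: arc_parallel_def)
    then have "ga a \<noteq> \<alpha> \<or> ga b \<noteq> \<alpha>" using ab munu by (auto simp: glue_arrow_def split: if_splits)
    moreover have "\<not> arc_parallel Q a \<mu>" "\<not> arc_parallel Q b \<mu>"
      using ab singleton by auto
    ultimately show False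
      using special_pair_arrows[of a b] not_special ab np munu by auto
  qed
  with munu singleton interpret glued_singleton Q Z Z\<^sub>B \<alpha> \<beta> \<mu> \<nu>
    by unfold_locales blast+
  show ?thesis by (rule HH1_isomorphic) fact+
qed

end
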